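(* Let $A\in\mathbb{C}^{n\times n}$ be skew-Hermitian, $B\in\mathbb{C}^{n\times m}$, with $b_k$, $\delta_k$ and the closed-loop decay rate $\gamma_{\mathrm{decay}}=\gamma_{\mathrm{decay}}(A,B)$ as in the context. Set $$\varphi_k=\frac{2\|B\|^2}{(2-\sqrt2)^2\delta_k^2},\qquad 1\le k\le n.$$ Suppose $\varphi_k<1$ for at least one index $k$. Put $$\Gamma_+=\min\{(1+\varphi_k)\|b_k\|:\ \varphi_k<1\},\qquad \Gamma_-=\min_{k}(1-\varphi_k)\|b_k\|.$$ Then $\gamma_{\mathrm{decay}}<\Gamma_+$. If moreover $\varphi_k<1$ for all $k$, then $$\Gamma_-<\gamma_{\mathrm{decay}}<\Gamma_+.$$
   Context: Standing setting: $n\ge 2$, $1\le m\le n$; $A\in\mathbb{C}^{n\times n}$ is skew-Hermitian ($A^*=-A$); $B\in\mathbb{C}^{n\times m}$ with $\ker B=\{0\}$; the pair $(A,B)$ is stabilizable (equivalently, since $A$ is skew-Hermitian, controllable). $\|\cdot\|$ is the Euclidean norm of vectors and the induced operator norm of matrices. The eigenvalues of $A$, listed with multiplicity, are $i\lambda_1,\dots,i\lambda_n$ with $\lambda_1\le\dots\le\lambda_n$ real; $v_1,\dots,v_n$ is an orthonormal basis of $\mathbb{C}^n$ with $Av_j=i\lambda_jv_j$; $b_j=B^*v_j$; $\delta_k=\min_{j\ne k}|\lambda_j-\lambda_k|$ (with $\varphi_k=+\infty$ if $\delta_k=0$; $\Gamma_-$ is only used when all $\varphi_k<1$). Linear quadratic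 regulator: for $x'(t)=Ax(t)+Bu(t)$, $x(0)=x_0$, minimize $J^u(x_0)=\int_0^\infty x(t)^*x(t)+u(t)^*u(t)\,dt$. The optimal control is $u=-Fx$, $F=B^*X$, where $X$ is the unique nonnegative (in fact positive definite) solution of $XBB^*X-XA-A^*X-I=0$. The closed-loop matrix is $A_{\mathrm{cl.loop}}=A-BB^*X$; it is stable. Put $\gamma_{\mathrm{decay}}(A,B)=\min\{|\operatorname{Re}\nu|:\nu\text{ an eigenvalue of }A_{\mathrm{cl.loop}}\}$. *)

theory Defs
  imports "HOL-Analysis.Analysis"
begin

text \<open>
  An $n \times m$ complex matrix has type \<open>complex^'m^'n\<close>, so that it maps \<open>complex^'m\<close> to
  \<open>complex^'n\<close> via \<open>(*v)\<close>. The library norm on \<open>complex^'n\<close> is the Euclidean one, and the induced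
  operator norm of \<open>B\<close> is \<open>onorm ((*v) B)\<close>. The library norm on matrices is \<^emph>\<open>not\<close> the operator
  norm.
\<close>

definition adj :: "complex^'m^'n \<Rightarrow> complex^'n^'m" where
  "adj M = (\<chi> i j. cnj (M $ j $ i))"

definition cinner :: "complex^'n \<Rightarrow> complex^'n \<Rightarrow> complex" where
  "cinner x y = (\<Sum>i\<in>UNIV. cnj (x $ i) * y $ i)"

definition skew_hermitian :: "complex^'n^'n \<Rightarrow> bool" where
  "skew_hermitian A \<longleftrightarrow> adj A = - A"

definition hermitian_nonneg :: "complex^'n^'n \<Rightarrow> bool" where
  "hermitian_nonneg X \<longleftrightarrow> adj X = X \<and> (\<forall>x. 0 \<le> Re (cinner x (X *v x)))"

definition eigenvalues :: "complex^'n^'n \<Rightarrow> complex set" where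
  "eigenvalues M = {\<nu>. \<exists>x. x \<noteq> 0 \<and> M *v x = \<nu> *s x}"

definition stable_matrix :: "complex^'n^'n \<Rightarrow> bool" where
  "stable_matrix M \<longleftrightarrow> (\<forall>\<nu>\<in>eigenvalues M. Re \<nu> < 0)"

definition stabilizable :: "complex^'n^'n \<Rightarrow> complex^'m^'n \<Rightarrow> bool" where
  "stabilizable A B \<longleftrightarrow> (\<exists>F :: complex^'n^'m. stable_matrix (A - B ** F))"

definition orthonormal_basis :: "nat set \<Rightarrow> (nat \<Rightarrow> complex^'n) \<Rightarrow> bool" where
  "orthonormal_basis I v \<longleftrightarrow>
     (\<forall>j\<in>I. \<forall>k\<in>I. cinner (v j) (v k) = (if j = k then 1 else 0)) \<and> vec.span (v ` I) = UNIV"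


text \<open>
  The Riccati equation of the regulator problem with cost $\int_0^\infty x^*x + u^*u\,dt$. For
  stabilizable \<open>(A, B)\<close> it has exactly one nonnegative solution, so the definite description below
  denotes it.
\<close>

definition riccati_equation :: "complex^'n^'n \<Rightarrow> complex^'m^'n \<Rightarrow> complex^'n^'n \<Rightarrow> bool" where
  "riccati_equation A B X \<longleftrightarrow>
     X ** B ** adj B ** X - X ** A - adj A ** X - mat 1 = 0"

definition riccati_solution :: "complex^'n^'n \<Rightarrow> complex^'m^'n \<Rightarrow> complex^'n^'n" where
  "riccati_solution A B = (THE X. hermitian_nonneg X \<and> riccati_equation A B X)"

definition closed_loop :: "complex^'n^'n \<Rightarrow> complex^'m^'n \<Rightarrow> complex^'n^'n" where
  "closed_loop A B = A - B ** adj B ** riccati_solution A B"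

definition gamma_decay :: "complex^'n^'n \<Rightarrow> complex^'m^'n \<Rightarrow> real" where
  "gamma_decay A B = Min ((\<lambda>\<nu>. \<bar>Re \<nu>\<bar>) ` eigenvalues (closed_loop A B))"


text \<open>
  The numbers \<open>lam 1, \<dots>, lam n\<close> and vectors \<open>v 1, \<dots>, v n\<close> are given by functions on \<open>nat\<close> of which
  only the values on \<open>{1..n}\<close> matter; \<open>n = CARD('n)\<close>.
\<close>

definition spectral_gap :: "nat \<Rightarrow> (nat \<Rightarrow> real) \<Rightarrow> nat \<Rightarrow> real" where
  "spectral_gap n lam k = Min ((\<lambda>j. \<bar>lam j - lam k\<bar>) ` ({1..n} - {k}))"

text \<open>
  The value for a vanishing gap is \<open>\<infinity>\<close>, hence the codomain \<open>ereal\<close>; real division by zero would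
  give \<open>0\<close>.
\<close>

definition phi :: "complex^'m^'n \<Rightarrow> (nat \<Rightarrow> real) \<Rightarrow> nat \<Rightarrow> ereal" where
  "phi B lam k =
     (let \<delta> = spectral_gap CARD('n) lam k in
      if \<delta> = 0 then \<infinity>
      else ereal (2 * (onorm ((*v) B))\<^sup>2 / ((2 - sqrt 2)\<^sup>2 * \<delta>\<^sup>2)))"

definition Gamma_plus :: "complex^'m^'n \<Rightarrow> (nat \<Rightarrow> real) \<Rightarrow> (nat \<Rightarrow> complex^'n) \<Rightarrow> ereal" where
  "Gamma_plus B lam v =
     Min ((\<lambda>k. (1 + phi B lam k) * ereal (norm (adj B *v v k))) ` {k \<in> {1..CARD('n)}. phi B lam k < 1})"

definition Gamma_minus :: "complex^'m^'n \<Rightarrow> (nat \<Rightarrow> real) \<Rightarrow> (nat \<Rightarrow> complex^'n) \<Rightarrow> ereal" where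
  "Gamma_minus B lam v =
     Min ((\<lambda>k. (1 - phi B lam k) * ereal (norm (adj B *v v k))) ` {1..CARD('n)})"

end

theory Submission
  imports Defs
begin

text \<open>
  The inverse \<open>Z = X\<inverse>\<close> of a Riccati solution satisfies \<open>Z\<^sup>2 + A Z - Z A = B B\<^sup>*\<close>, which for
  skew-Hermitian \<open>A\<close> yields the factorization \<open>(A - s)\<^sup>2 - B B\<^sup>* = (Z + A - s) (A - Z - s)\<close>. Since
  \<open>closed_loop A B\<close> is similar to \<open>A - Z\<close>, its eigenvalues are the \<open>s\<close> with \<open>Re s < 0\<close> for which
  \<open>(A - s)\<^sup>2 y = B B\<^sup>* y\<close> has a solution \<open>y \<noteq> 0\<close>.

  With \<open>\<mu>\<^sub>j = \<i> \<lambda>\<^sub>j - s\<close> and \<open>u\<close> a multiple of \<open>B\<^sup>* y\<close>, the quadratic eigenvalue problem becomes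
  \<open>u = b\<^sub>k + R u\<close> and \<open>\<langle>b\<^sub>k, u\<rangle> = \<mu>\<^sub>k\<^sup>2\<close>, where \<open>R\<close> collects the contributions of the indices \<open>j \<noteq> k\<close>. If
  \<open>\<bar>\<mu>\<^sub>j\<bar> \<ge> \<delta>\<^sub>k / 2\<close> for these \<open>j\<close>, then \<open>\<parallel>R\<parallel> \<le> \<rho> = 4 \<parallel>B\<parallel>\<^sup>2 / \<delta>\<^sub>k\<^sup>2 < 3/4 \<phi>\<^sub>k\<close>, which forces
  \<open>\<parallel>b\<^sub>k\<parallel>\<^sup>2 / (1 + \<rho>) \<le> (Re s)\<^sup>2 \<le> \<parallel>b\<^sub>k\<parallel>\<^sup>2 / (1 - \<rho>)\<close>. For the lower bound on the decay rate \<open>k\<close> is chosen with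
  \<open>\<lambda>\<^sub>k\<close> closest to \<open>Im s\<close>; for the upper bound Brouwer's theorem, applied to
  \<open>\<mu> \<mapsto> \<langle>b\<^sub>k, (1 - R(\<mu>))\<inverse> b\<^sub>k\<rangle>\<^bsup>1/2\<^esup>\<close>, provides an eigenvalue near \<open>\<i> \<lambda>\<^sub>k\<close>.
\<close>

section \<open>Complex inner product, adjoints and Lyapunov equations\<close>

lemma Re_cinner: "Re (cinner x y) = x \<bullet> y"
  by (simp add: cinner_def inner_vec_def inner_complex_def)

lemma cinner_commute: "cinner y x = cnj (cinner x y)"
  by (simp add: cinner_def mult.commute)

lemma cinner_add_right: "cinner x (y + z) = cinner x y + cinner x z"
  and cinner_diff_right: "cinner x (y - z) = cinner x y - cinner x z"
  and cinner_smult_right: "cinner x (c *s y) = c * cinner x y"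
  and cinner_smult_left: "cinner (c *s x) y = cnj c * cinner x y"
  and cinner_zero_right [simp]: "cinner x 0 = 0"
  and cinner_zero_left [simp]: "cinner 0 x = 0"
  by (simp_all add: cinner_def algebra_simps sum.distrib sum_subtractf sum_distrib_left)

lemma cinner_sum_right: "cinner x (\<Sum>j\<in>J. f j) = (\<Sum>j\<in>J. cinner x (f j))"
  by (induction J rule: infinite_finite_induct) (simp_all add: cinner_add_right)

lemma cinner_self: "cinner x x = complex_of_real ((norm x)\<^sup>2)"
proof -
  have "Im (cinner x x) = 0"
    by (simp add: cinner_def algebra_simps)
  then show ?thesis
    by (simp add: complex_eq_iff Re_cinner power2_norm_eq_inner)
qed

lemma norm_smult: "norm (c *s x) = cmod c * norm (x :: complex^'n)"
  unfolding norm_vec_def L2_set_def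
  by (simp add: norm_mult power_mult_distrib sum_distrib_left[symmetric] real_sqrt_mult)

text \<open>Scaling \<open>x\<close> by \<open>c\<close> turns the product into the real number
  |c|^2, so the real Cauchy-Schwarz inequality applies.\<close>

lemma norm_cinner_le: "cmod (cinner x y) \<le> norm x * norm y"
proof -
  define c where "c = cinner x y"
  have "cinner (c *s x) y = complex_of_real ((cmod c)\<^sup>2)"
    by (simp add: cinner_smult_left c_def mult.commute flip: complex_norm_square)
  then have "(cmod c)\<^sup>2 = (c *s x) \<bullet> y"
    by (metis Re_cinner Re_complex_of_real)
  also have "\<dots> \<le> cmod c * (norm x * norm y)"
    using norm_cauchy_schwarz[of "c *s x" y] by (simp add: norm_smult)
  finally show ?thesis
    by (cases "c = 0") (auto simp: power2_eq_square c_def)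
qed

lemma cinner_adj: "cinner (adj M *v x) y = cinner x (M *v y)"
proof -
  have "cinner (adj M *v x) y = (\<Sum>i\<in>UNIV. \<Sum>j\<in>UNIV. M $ j $ i * cnj (x $ j) * y $ i)"
    by (simp add: cinner_def adj_def matrix_vector_mult_def sum_distrib_right)
  also have "\<dots> = (\<Sum>j\<in>UNIV. \<Sum>i\<in>UNIV. M $ j $ i * cnj (x $ j) * y $ i)"
    by (rule sum.swap)
  also have "\<dots> = cinner x (M *v y)"
    by (simp add: cinner_def matrix_vector_mult_def sum_distrib_left algebra_simps)
  finally show ?thesis .
qed

lemma adj_adj [simp]: "adj (adj M) = M"
  by (simp add: adj_def vec_eq_iff)

lemma adj_add: "adj (M + N) = adj M + adj N"
  and adj_diff: "adj (M - N) = adj M - adj N"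
  and adj_uminus: "adj (- M) = - adj M"
  and adj_mat: "adj (mat c) = mat (cnj c)"
  by (simp_all add: adj_def vec_eq_iff mat_def)

lemma adj_mult: "adj (M ** N) = adj N ** adj M"
  by (simp add: adj_def vec_eq_iff matrix_matrix_mult_def mult.commute)

lemma inner_adj: "(adj M *v x) \<bullet> y = x \<bullet> (M *v y)"
  by (metis Re_cinner cinner_adj)

lemma inner_adj': "(M *v x) \<bullet> y = x \<bullet> (adj M *v y)"
  by (metis adj_adj inner_adj)

lemma mat_mult_vec: "mat c *v x = c *s (x :: 'a::comm_semiring_1^'n)"
  by (simp add: vec_eq_iff matrix_vector_mult_def mat_def if_distrib[of "\<lambda>y. y * _"] cong: if_cong)

lemma smult_of_real: "complex_of_real r *s x = r *\<^sub>R x"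
  by (simp add: vec_eq_iff) (simp add: scaleR_conv_of_real)

lemma matrix_vec_smult: "M *v (c *s x) = c *s (M *v (x :: complex^'n))"
  by (simp add: vector_scalar_commute)

lemma matrix_uminus_vec: "(- M) *v x = - (M *v (x :: complex^'n))"
  using matrix_vector_mult_diff_rdistrib[of 0 M x] by simp

lemma matrix_vec_scaleR: "M *v (r *\<^sub>R x) = r *\<^sub>R (M *v (x :: complex^'n))"
  by (metis matrix_vec_smult smult_of_real)

lemma matrix_uminus_right: "M *v (- x) = - (M *v (x :: complex^'n))"
  using matrix_vec_scaleR[of M "-1" x] by simp

lemmas mat_vec = matrix_vector_mul_assoc[symmetric] matrix_vector_mult_add_rdistrib
  matrix_vector_mult_diff_rdistrib matrix_vector_right_distrib matrix_vector_mult_diff_distrib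
  mat_mult_vec matrix_vec_smult matrix_uminus_vec

text \<open>This is \<open>hermitian_nonneg\<close>, phrased with the real inner product \<open>x \<bullet> y = Re (cinner x y)\<close>.\<close>

definition psd :: "complex^'n^'n \<Rightarrow> bool" where
  "psd X \<longleftrightarrow> adj X = X \<and> (\<forall>x. 0 \<le> x \<bullet> (X *v x))"

lemma hermitian_nonneg_iff_psd: "hermitian_nonneg X \<longleftrightarrow> psd X"
  by (simp add: hermitian_nonneg_def psd_def Re_cinner)

text \<open>The form at \<open>x + t y\<close> is a quadratic polynomial in the real variable
  \<open>t\<close> without negative values.\<close>

lemma psd_cauchy_schwarz:
  assumes "psd X"
  shows "(y \<bullet> (X *v x))\<^sup>2 \<le> (x \<bullet> (X *v x)) * (y \<bullet> (X *v y))"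
proof -
  define s p q where "s = y \<bullet> (X *v x)" and "p = x \<bullet> (X *v x)" and "q = y \<bullet> (X *v y)"
  have sym: "x \<bullet> (X *v y) = s"
    using assms unfolding psd_def s_def by (metis inner_adj inner_commute)
  have quad: "0 \<le> p + 2 * t * s + t\<^sup>2 * q" for t
  proof -
    have "0 \<le> (x + t *\<^sub>R y) \<bullet> (X *v (x + t *\<^sub>R y))"
      using assms by (simp add: psd_def)
    also have "\<dots> = p + 2 * t * s + t\<^sup>2 * q"
      by (simp add: matrix_vector_right_distrib matrix_vec_scaleR inner_add_left
          inner_add_right sym s_def[symmetric] p_def[symmetric] q_def[symmetric]
          algebra_simps power2_eq_square)
    finally show ?thesis .
  qed
  have "q \<ge> 0" using assms by (simp add: q_def psd_def)
  have "s\<^sup>2 \<le> p * q"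
  proof (cases "q = 0")
    case True
    \<comment> \<open>With \<open>q = 0\<close> the polynomial is affine; if \<open>s\<close> were
      nonzero, this \<open>t\<close> would give it the value -1.\<close>
    then have "s = 0"
      using quad[of "- (p + 1) / (2 * s)"] by (cases "s = 0") (auto simp: field_simps)
    then show ?thesis using True by simp
  next
    case False
    \<comment> \<open>\<open>t = - s / q\<close> minimizes the polynomial.\<close>
    then show ?thesis
      using quad[of "- s / q"] \<open>q \<ge> 0\<close> by (simp add: field_simps power2_eq_square)
  qed
  then show ?thesis by (simp add: s_def p_def q_def)
qed

text \<open>Cauchy-Schwarz for the form, tested against \<open>y = X *v x\<close>, bounds |Xx|^4 by
  zero.\<close>

lemma psd_null:
  assumes "psd X" and "x \<bullet> (X *v x) = 0"
  shows "X *v x = 0"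
  using psd_cauchy_schwarz[OF assms(1), of "X *v x" x] assms(2) by simp

text \<open>The vector minimizes the Rayleigh quotient. Then \<open>V - w\<close> is psd and its
  form vanishes at the minimizer, so \<open>psd_null\<close> applies.\<close>

lemma hermitian_min_eigenvector:
  fixes V :: "complex^'n^'n"
  assumes "adj V = V"
  obtains x w where "norm x = 1" "V *v x = w *\<^sub>R x" "\<And>y. w * (norm y)\<^sup>2 \<le> y \<bullet> (V *v y)"
proof -
  have "continuous_on (sphere 0 1) (\<lambda>x. x \<bullet> (V *v x))"
    by (intro continuous_on_inner continuous_on_id linear_continuous_on matrix_vector_mul_bounded_linear)
  moreover have "sphere 0 1 \<noteq> ({} :: (complex^'n) set)"
    by (auto intro!: exI[of _ "axis undefined 1"] simp: ex_in_conv[symmetric])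
  ultimately obtain x :: "complex^'n" where x: "norm x = 1"
    and min: "\<And>y. norm y = 1 \<Longrightarrow> x \<bullet> (V *v x) \<le> y \<bullet> (V *v y)"
    using continuous_attains_inf[of "sphere 0 1" "\<lambda>x. x \<bullet> (V *v x)"] by auto
  define w where "w = x \<bullet> (V *v x)"
  have low: "w * (norm y)\<^sup>2 \<le> y \<bullet> (V *v y)" for y
  proof (cases "y = 0")
    case False
    have "w \<le> ((1 / norm y) *\<^sub>R y) \<bullet> (V *v ((1 / norm y) *\<^sub>R y))"
      using min[of "(1 / norm y) *\<^sub>R y"] False by (simp add: w_def)
    then show ?thesis
      using False by (simp add: matrix_vec_scaleR field_simps power2_eq_square)
  qed simp
  let ?U = "V - mat (complex_of_real w)"
  have U: "?U *v y = V *v y - w *\<^sub>R y" for y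
    by (simp add: mat_vec smult_of_real)
  have "psd ?U"
    using low by (simp add: psd_def adj_diff adj_mat assms U inner_diff_right power2_norm_eq_inner)
  moreover have "x \<bullet> (?U *v x) = 0"
    using x by (simp add: U inner_diff_right w_def[symmetric] power2_norm_eq_inner[symmetric])
  ultimately have "V *v x = w *\<^sub>R x"
    using psd_null[of ?U x] by (simp add: U)
  then show thesis using that x low by blast
qed

section \<open>Lyapunov equations\<close>

text \<open>At an eigenvector for the least eigenvalue \<open>w\<close> of \<open>V\<close>, the
  Lyapunov form equals \<open>2 * w * (x \<bullet> (G *v x))\<close>. Its sign is that of
  \<open>w\<close>.\<close>

lemma lyapunov_psd:
  assumes G: "\<And>x. x \<noteq> 0 \<Longrightarrow> x \<bullet> (G *v x) > 0"
    and V: "adj V = V" and Q: "\<And>x. 0 \<le> x \<bullet> ((adj G ** V + V ** G) *v x)"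
  shows "psd V"
proof -
  obtain x w where x: "norm x = 1" "V *v x = w *\<^sub>R x"
    and low: "\<And>y. w * (norm y)\<^sup>2 \<le> y \<bullet> (V *v y)"
    using hermitian_min_eigenvector[OF V] by blast
  have "x \<bullet> (V *v (G *v x)) = w * (x \<bullet> (G *v x))"
    by (metis inner_adj inner_scaleR_left V x(2))
  then have "x \<bullet> ((adj G ** V + V ** G) *v x) = 2 * w * (x \<bullet> (G *v x))"
    by (simp add: mat_vec x inner_add_right matrix_vec_scaleR inner_adj'[symmetric]
        inner_commute)
  moreover have "x \<bullet> (G *v x) > 0" using G[of x] x by fastforce
  ultimately have "w \<ge> 0" using Q[of x] by (simp add: zero_le_mult_iff)
  then have "0 \<le> y \<bullet> (V *v y)" for y
    using low[of y] by (meson mult_nonneg_nonneg order_trans zero_le_power2)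
  then show ?thesis by (simp add: psd_def V)
qed

text \<open>\<open>lyapunov_psd\<close> is applied to \<open>- (adj W ** W)\<close>: the equation
  lets \<open>adj G\<close> pass through \<open>W\<close>, which makes the Lyapunov form
  nonnegative. \<open>W\<close> may be non-Hermitian, as injectivity of the Lyapunov operator on all
  matrices requires.\<close>

lemma lyapunov_unique:
  assumes G: "\<And>x. x \<noteq> 0 \<Longrightarrow> x \<bullet> (G *v x) > 0"
    and W: "adj G ** W + W ** G = 0"
  shows "W = 0"
proof -
  let ?V = "- (adj W ** W)"
  have GW: "adj G *v (W *v x) = - (W *v (G *v x))" for x
    using arg_cong[OF W, of "\<lambda>M. M *v x"] by (simp add: mat_vec add_eq_0_iff)
  have "x \<bullet> ((adj G ** ?V + ?V ** G) *v x) = 2 * ((W *v x) \<bullet> (G *v (W *v x)))" for x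
  proof -
    have "x \<bullet> ((adj G ** ?V + ?V ** G) *v x)
        = - ((W *v (G *v x)) \<bullet> (W *v x)) - (W *v x) \<bullet> (W *v (G *v x))"
      by (simp add: mat_vec inner_add_right inner_diff_right inner_adj'[symmetric]
          matrix_uminus_right)
    also have "\<dots> = 2 * ((W *v x) \<bullet> (adj G *v (W *v x)))"
      by (simp add: GW inner_commute)
    also have "\<dots> = 2 * ((W *v x) \<bullet> (G *v (W *v x)))"
      by (metis inner_adj inner_commute)
    finally show ?thesis .
  qed
  moreover have "0 \<le> (W *v x) \<bullet> (G *v (W *v x))" for x
    using G[of "W *v x"] by (cases "W *v x = 0") auto
  ultimately have "psd ?V"
    by (intro lyapunov_psd[OF G]) (simp_all add: adj_mult adj_uminus)
  then have "0 \<le> - ((W *v x) \<bullet> (W *v x))" for x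
    by (simp add: psd_def mat_vec inner_adj'[symmetric])
  then have "W *v x = 0" for x
    by (metis inner_ge_zero inner_eq_zero_iff neg_0_le_iff_le order_antisym)
  then show ?thesis by (simp add: matrix_eq)
qed

lemma matrix_add_rdistrib: "(M + N) ** K = M ** K + N ** (K :: complex^'m^'k)"
  by (simp add: vec_eq_iff matrix_matrix_mult_def distrib_right sum.distrib)

lemma matrix_mult_scaleR:
  fixes M :: "complex^'k^'n" and N :: "complex^'m^'k"
  shows "M ** (r *\<^sub>R N) = r *\<^sub>R (M ** N)" and "(r *\<^sub>R M) ** N = r *\<^sub>R (M ** N)"
  by (simp_all add: vec_eq_iff matrix_matrix_mult_def scaleR_sum_right)

text \<open>The Lyapunov operator is real-linear and injective on a finite-dimensional space, hence
  surjective. It commutes with \<open>adj\<close>, so a Hermitian right-hand side has a Hermitian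
  preimage.\<close>

lemma lyapunov_solution:
  fixes G E :: "complex^'n^'n"
  assumes G: "\<And>x. x \<noteq> 0 \<Longrightarrow> x \<bullet> (G *v x) > 0" and E: "adj E = E"
  obtains W where "adj W = W" "adj G ** W + W ** G = E"
proof -
  define L where "L W = adj G ** W + W ** G" for W
  have "linear L"
    by (rule linearI)
      (simp_all add: L_def matrix_add_ldistrib matrix_add_rdistrib matrix_mult_scaleR scaleR_add_right)
  moreover have "W = 0" if "L W = 0" for W
    using G that unfolding L_def by (rule lyapunov_unique)
  ultimately have "inj L"
    by (metis linear_injective_0)
  with \<open>linear L\<close> have "surj L"
    by (rule eucl.linear_inj_imp_surj)
  then obtain W where W: "L W = E"
    by (metis surjD)
  have "L (adj W) = adj (L W)"
    by (simp add: L_def adj_add adj_mult add.commute)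
  also have "\<dots> = L W"
    by (simp add: W E)
  finally have "adj W = W"
    using \<open>inj L\<close> by (rule injD[rotated])
  with W that show thesis
    unfolding L_def by blast
qed

section \<open>The cone of psd matrices: closedness, bounds, trace\<close>

lemma psd_0: "psd (0 :: complex^'n^'n)"
  by (simp add: psd_def adj_def vec_eq_iff)

lemma psd_add: "psd X \<Longrightarrow> psd Y \<Longrightarrow> psd (X + Y)"
  by (simp add: psd_def adj_add mat_vec inner_add_right)

lemma psd_adj_mult: "psd (adj W ** W)"
  by (simp add: psd_def adj_mult mat_vec inner_adj'[symmetric])

lemma continuous_on_adj [continuous_intros]:
  "continuous_on S f \<Longrightarrow> continuous_on S (\<lambda>x. adj (f x))"
  unfolding adj_def by (intro continuous_intros)

lemma continuous_on_matrix_mult [continuous_intros]: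
  fixes f :: "_ \<Rightarrow> complex^'k^'n" and g :: "_ \<Rightarrow> complex^'m^'k"
  shows "continuous_on S f \<Longrightarrow> continuous_on S g \<Longrightarrow> continuous_on S (\<lambda>x. f x ** g x)"
  unfolding matrix_matrix_mult_def by (intro continuous_intros)

lemma continuous_on_matrix_vector_mult [continuous_intros]:
  fixes f :: "_ \<Rightarrow> complex^'k^'n" and g :: "_ \<Rightarrow> complex^'k"
  shows "continuous_on S f \<Longrightarrow> continuous_on S g \<Longrightarrow> continuous_on S (\<lambda>x. f x *v g x)"
  unfolding matrix_vector_mult_def by (intro continuous_intros)

lemma closed_psd:
  fixes f :: "complex^'n^'n \<Rightarrow> complex^'m^'m"
  assumes "continuous_on UNIV f"
  shows "closed {Z. psd (f Z)}"
  unfolding psd_def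
  by (intro closed_Collect_conj closed_Collect_all closed_Collect_eq closed_Collect_le
      continuous_intros assms)

lemma matrix_axis_component: "(M *v axis j 1) $ i = (M $ i $ j :: complex)"
  by (simp add: matrix_vector_mult_def axis_def if_distrib[of "\<lambda>y. _ * y"] cong: if_cong)

text \<open>Cauchy-Schwarz for the form of \<open>X\<close> against \<open>X *v x\<close> gives
  |Xx|^4 \<le> c |x|^2 c |Xx|^2, and |Xx|^2 cancels.\<close>

lemma psd_norm_le:
  assumes X: "psd X" and c: "psd (mat (complex_of_real c) - X)"
  shows "norm (X *v x) \<le> c * norm x"
proof -
  have le: "0 \<le> y \<bullet> (X *v y)" "y \<bullet> (X *v y) \<le> c * (norm y)\<^sup>2" for y
    using X c by (auto simp: psd_def mat_vec smult_of_real inner_diff_right power2_norm_eq_inner)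
  show ?thesis
  proof (cases "x = 0")
    case False
    then have "0 \<le> c"
      using order_trans[OF le(1) le(2), of x] by (simp add: zero_le_mult_iff)
    have "((norm (X *v x))\<^sup>2)\<^sup>2 \<le> (x \<bullet> (X *v x)) * ((X *v x) \<bullet> (X *v (X *v x)))"
      using psd_cauchy_schwarz[OF X, of "X *v x" x] by (simp add: power2_norm_eq_inner)
    also have "\<dots> \<le> (c * (norm x)\<^sup>2) * (c * (norm (X *v x))\<^sup>2)"
      using \<open>0 \<le> c\<close> by (intro mult_mono le) auto
    finally have "(norm (X *v x))\<^sup>2 * (norm (X *v x))\<^sup>2 \<le> (c * norm x)\<^sup>2 * (norm (X *v x))\<^sup>2"
      by (simp add: power2_eq_square mult_ac)
    then have "(norm (X *v x))\<^sup>2 \<le> (c * norm x)\<^sup>2 \<or> norm (X *v x) = 0"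
      by (metis mult_le_cancel_right not_less zero_less_power2)
    then show ?thesis
      using \<open>0 \<le> c\<close> by (auto intro: power2_le_imp_le)
  qed simp
qed

text \<open>Boundedness refers to the library norm of matrices, so \<open>psd_norm_le\<close> is
  applied to the axis vectors to bound each entry.\<close>

lemma bounded_psd_le: "bounded {X :: complex^'n^'n. psd X \<and> psd (mat (complex_of_real c) - X)}"
proof (rule boundedI)
  fix X :: "complex^'n^'n"
  assume X: "X \<in> {X. psd X \<and> psd (mat (complex_of_real c) - X)}"
  have entry: "norm (X $ i $ j) \<le> c" for i j
  proof -
    have "norm (X $ i $ j) = norm ((X *v axis j 1) $ i)"
      by (simp add: matrix_axis_component)
    also have "\<dots> \<le> norm (X *v axis j 1)"
      by (rule Finite_Cartesian_Product.norm_nth_le)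
    also have "\<dots> \<le> c"
      using psd_norm_le[of X c "axis j 1"] X by simp
    finally show ?thesis .
  qed
  have "norm X \<le> (\<Sum>i\<in>UNIV. norm (X $ i))"
    unfolding norm_vec_def by (rule L2_set_le_sum) simp
  also have "\<dots> \<le> (\<Sum>(i::'n)\<in>UNIV. \<Sum>(j::'n)\<in>UNIV. c)"
  proof (rule sum_mono)
    fix i
    have "norm (X $ i) \<le> (\<Sum>j\<in>UNIV. norm (X $ i $ j))"
      unfolding norm_vec_def[of "X $ i"] by (rule L2_set_le_sum) simp
    also have "\<dots> \<le> (\<Sum>(j::'n)\<in>UNIV. c)"
      by (intro sum_mono entry)
    finally show "norm (X $ i) \<le> (\<Sum>(j::'n)\<in>UNIV. c)" .
  qed
  finally show "norm X \<le> (\<Sum>(i::'n)\<in>UNIV. \<Sum>(j::'n)\<in>UNIV. c)" .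
qed

text \<open>The sum is the trace of \<open>W\<close>. Its nonnegative terms all vanish, and
  \<open>psd_null\<close> then annihilates every column.\<close>

lemma psd_eq_0:
  assumes "psd W" and "(\<Sum>i\<in>UNIV. axis i 1 \<bullet> (W *v axis i 1)) \<le> 0"
  shows "W = 0"
proof -
  have nn: "0 \<le> axis i 1 \<bullet> (W *v axis i 1)" for i
    using assms(1) by (simp add: psd_def)
  then have "(\<Sum>i\<in>UNIV. axis i 1 \<bullet> (W *v axis i 1)) = 0"
    using assms(2) by (intro order_antisym sum_nonneg)
  then have "axis i 1 \<bullet> (W *v axis i 1) = 0" for i
    using nn by (simp add: sum_nonneg_eq_0_iff)
  then have "W *v axis i 1 = 0" for i
    by (rule psd_null[OF assms(1)])
  then have "W $ i $ j = 0" for i j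
    using matrix_axis_component[of W j i] by simp
  then show ?thesis
    by (simp add: vec_eq_iff)
qed

section \<open>Operator norm bounds and finiteness of the spectrum\<close>

lemma norm_matrix_vec_le: "norm (M *v x) \<le> onorm ((*v) M) * norm (x :: complex^'n)"
  by (rule onorm) simp

text \<open>Write |M* x|^2 as the product of \<open>x\<close> with M M* x, estimate it by
  Cauchy-Schwarz, and cancel one factor |M* x|.\<close>

lemma norm_adj_vec_le: "norm (adj M *v x) \<le> onorm ((*v) M) * norm (x :: complex^'n)"
proof -
  have "norm (adj M *v x) * norm (adj M *v x) = x \<bullet> (M *v (adj M *v x))"
    by (metis inner_adj power2_eq_square power2_norm_eq_inner)
  also have "\<dots> \<le> norm x * norm (M *v (adj M *v x))"
    by (rule norm_cauchy_schwarz)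
  also have "\<dots> \<le> norm x * (onorm ((*v) M) * norm (adj M *v x))"
    by (intro mult_left_mono norm_matrix_vec_le) simp
  finally show ?thesis
    by (cases "adj M *v x = 0") (auto simp: onorm_pos_le mult_ac)
qed

text \<open>Eigenvectors for distinct eigenvalues are independent. Finiteness gives the
  \<open>Min\<close> in \<open>gamma_decay\<close> its meaning.\<close>

lemma finite_eigenvalues: "finite (eigenvalues (M :: complex^'n^'n))"
proof -
  have "\<forall>s\<in>eigenvalues M. \<exists>x. x \<noteq> 0 \<and> M *v x = s *s x"
    by (simp add: eigenvalues_def)
  from bchoice[OF this] obtain e where
    e: "\<And>s. s \<in> eigenvalues M \<Longrightarrow> e s \<noteq> 0 \<and> M *v e s = s *s e s"
    by blast
  have inj: "inj_on e (eigenvalues M)"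
    by (rule inj_onI) (metis e vector_mul_rcancel)
  have indep: "\<forall>s\<in>S. c s = 0"
    if "finite S" "S \<subseteq> eigenvalues M" "(\<Sum>s\<in>S. c s *s e s) = 0" for S c
    using that
  proof (induction S arbitrary: c rule: finite_induct)
    case (insert t S)
    \<comment> \<open>Applying \<open>M - t\<close> to the relation removes the term at
      \<open>t\<close> and multiplies the others by the nonzero numbers
      \<open>s - t\<close>.\<close>
    have "0 = M *v (\<Sum>s\<in>insert t S. c s *s e s) - t *s (\<Sum>s\<in>insert t S. c s *s e s)"
      using insert.prems by simp
    also have "\<dots> = (\<Sum>s\<in>insert t S. (c s * (s - t)) *s e s)"
    proof -
      have "M *v (\<Sum>s\<in>insert t S. c s *s e s) = (\<Sum>s\<in>insert t S. c s *s (M *v e s))"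
        by (simp add: vec.linear_sum[OF matrix_vector_mul_linear_gen] matrix_vec_smult)
      also have "\<dots> = (\<Sum>s\<in>insert t S. c s *s (s *s e s))"
        using insert.prems(1) e by (intro sum.cong) auto
      finally show ?thesis
        by (simp add: vec.scale_sum_right sum_subtractf[symmetric] vector_smult_assoc
            vec.scale_left_diff_distrib right_diff_distrib mult.commute del: sum.insert)
    qed
    also have "\<dots> = (\<Sum>s\<in>S. (c s * (s - t)) *s e s)"
      using insert.hyps by simp
    finally have "\<forall>s\<in>S. c s * (s - t) = 0"
      using insert.IH[of "\<lambda>s. c s * (s - t)"] insert.prems by simp
    then have S: "\<forall>s\<in>S. c s = 0"
      using insert.hyps by auto
    then have "c t *s e t = 0"
      using insert.prems insert.hyps by simp
    then have "c t = 0"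
      using insert.prems e[of t] by (simp add: vec.scale_eq_0_iff)
    with S show ?case by simp
  qed simp
  have "vec.independent (e ` eigenvalues M)"
    unfolding vec.independent_explicit_finite_subsets
  proof (intro allI impI ballI)
    fix T u w
    assume T: "T \<subseteq> e ` eigenvalues M" "finite T" "(\<Sum>v\<in>T. u v *s v) = 0" "w \<in> T"
    then obtain S where S: "S \<subseteq> eigenvalues M" "finite S" "T = e ` S"
      by (meson finite_subset_image)
    then have "(\<Sum>s\<in>S. u (e s) *s e s) = 0"
      using T(3) inj by (simp add: sum.reindex inj_on_subset)
    then show "u w = 0"
      using indep[OF S(2,1), of "\<lambda>s. u (e s)"] T(4) S(3) by auto
  qed
  then have "finite (e ` eigenvalues M)"
    by (rule vec.finiteI_independent)
  then show ?thesis
    using inj by (simp add: finite_image_iff)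
qed

section \<open>The Riccati equation and the closed-loop spectrum\<close>

locale regulator =
  fixes A :: "complex^'n^'n" and B :: "complex^'m^'n" and I :: "nat set"
    and lam :: "nat \<Rightarrow> real" and v :: "nat \<Rightarrow> complex^'n"
  assumes skew: "adj A = - A"
    and finite_I: "finite I"
    and basis: "orthonormal_basis I v"
    and eigen: "\<And>j. j \<in> I \<Longrightarrow> A *v v j = (\<i> * complex_of_real (lam j)) *s v j"
    and stab: "stabilizable A B"
begin

section \<open>Expansion in the eigenbasis of \<open>A\<close>\<close>

lemma orthonormal: "j \<in> I \<Longrightarrow> k \<in> I \<Longrightarrow> cinner (v j) (v k) = (if j = k then 1 else 0)"
  using basis by (simp add: orthonormal_basis_def)

lemma cinner_basis_sum:
  assumes "J \<subseteq> I" "k \<in> I"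
  shows "cinner (v k) (\<Sum>j\<in>J. c j *s v j) = (if k \<in> J then c k else 0)"
proof -
  have "cinner (v k) (\<Sum>j\<in>J. c j *s v j) = (\<Sum>j\<in>J. if k = j then c j else 0)"
    using assms by (auto simp: cinner_sum_right cinner_smult_right orthonormal intro!: sum.cong)
  also have "\<dots> = (if k \<in> J then c k else 0)"
    using finite_subset[OF assms(1) finite_I] by simp
  finally show ?thesis .
qed

text \<open>The vectors that agree with their expansion form a subspace containing the basis, hence
  its whole span.\<close>

lemma expansion: "x = (\<Sum>j\<in>I. cinner (v j) x *s v j)"
proof -
  let ?S = "{x. x = (\<Sum>j\<in>I. cinner (v j) x *s v j)}"
  have "vec.subspace ?S"
  proof (rule vec.subspaceI)
    fix c x assume "x \<in> ?S"
    then have x: "(\<Sum>j\<in>I. cinner (v j) x *s v j) = x" by auto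
    have "(\<Sum>j\<in>I. cinner (v j) (c *s x) *s v j) = c *s (\<Sum>j\<in>I. cinner (v j) x *s v j)"
      by (simp add: cinner_smult_right vec.scale_sum_right vector_smult_assoc)
    then show "c *s x \<in> ?S"
      unfolding x by simp
  qed (auto simp: cinner_add_right vec.scale_left_distrib sum.distrib)
  moreover have "v ` I \<subseteq> ?S"
  proof clarify
    fix k assume "k \<in> I"
    then have "(\<Sum>j\<in>I. cinner (v j) (v k) *s v j) = (\<Sum>j\<in>I. if j = k then v j else 0)"
      by (intro sum.cong) (auto simp: orthonormal)
    then show "v k = (\<Sum>j\<in>I. cinner (v j) (v k) *s v j)"
      using \<open>k \<in> I\<close> finite_I by simp
  qed
  ultimately have "vec.span (v ` I) \<subseteq> ?S"
    by (rule vec.span_minimal[rotated])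
  then show ?thesis
    using basis by (auto simp: orthonormal_basis_def)
qed

lemma basis_eqI: "x = y" if "\<And>j. j \<in> I \<Longrightarrow> cinner (v j) x = cinner (v j) y"
  using expansion[of x] expansion[of y] that by (metis (no_types, lifting) sum.cong)

lemma parseval: "(norm x)\<^sup>2 = (\<Sum>j\<in>I. (cmod (cinner (v j) x))\<^sup>2)"
proof -
  have "complex_of_real ((norm x)\<^sup>2) = cinner x (\<Sum>j\<in>I. cinner (v j) x *s v j)"
    using expansion[of x] by (simp add: cinner_self)
  also have "\<dots> = (\<Sum>j\<in>I. cinner (v j) x * cnj (cinner (v j) x))"
    by (simp add: cinner_sum_right cinner_smult_right cinner_commute[of _ x])
  also have "\<dots> = complex_of_real (\<Sum>j\<in>I. (cmod (cinner (v j) x))\<^sup>2)"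
    by (simp flip: complex_norm_square)
  finally show ?thesis
    by (metis of_real_eq_iff)
qed

lemma inner_skew: "x \<bullet> (A *v y) = - ((A *v x) \<bullet> y)"
  by (simp add: inner_adj' skew matrix_uminus_vec)

lemma inner_skew_self: "x \<bullet> (A *v x) = 0"
  using inner_skew[of x x] by (simp add: inner_commute)

lemma cinner_basis_A: "j \<in> I \<Longrightarrow> cinner (v j) (A *v x) = \<i> * complex_of_real (lam j) * cinner (v j) x"
proof -
  assume "j \<in> I"
  have "cinner (v j) (A *v x) = cinner (- (A *v v j)) x"
    by (simp add: cinner_adj[symmetric] skew matrix_uminus_vec)
  also have "- (A *v v j) = (- (\<i> * complex_of_real (lam j))) *s v j"
    using \<open>j \<in> I\<close> by (simp add: eigen vector_smult_lneg)
  finally show ?thesis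
    unfolding cinner_smult_left by simp
qed

text \<open>Hautus test: an eigenvector \<open>x\<close> of \<open>A\<close> in the kernel of \<open>B\<^sup>*\<close> is a left eigenvector of every
  \<open>A - B F\<close>, with an eigenvalue on the imaginary axis.\<close>

lemma adj_B_eigenvector:
  assumes x: "x \<noteq> 0" "A *v x = \<mu> *s x"
  shows "adj B *v x \<noteq> 0"
proof
  assume Bx: "adj B *v x = 0"
  obtain F where F: "stable_matrix (A - B ** F)"
    using stab by (auto simp: stabilizable_def)
  have "Re \<mu> * (norm x)\<^sup>2 = 0"
  proof -
    have "Re (cinner x (A *v x)) = Re \<mu> * (norm x)\<^sup>2"
      by (simp add: x cinner_smult_right cinner_self)
    then show ?thesis
      by (simp add: Re_cinner inner_skew_self)
  qed
  then have Re: "Re \<mu> = 0" using x by simp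
  then have cnj: "cnj \<mu> = - \<mu>" by (simp add: complex_eq_iff)
  let ?N = "A - B ** F - mat \<mu>"
  have N: "?N *v y = (A - B ** F) *v y - \<mu> *s y" for y
    by (simp add: mat_vec)
  have "y = 0" if "?N *v y = 0" for y
  proof (rule ccontr)
    assume "y \<noteq> 0"
    then have "\<mu> \<in> eigenvalues (A - B ** F)"
      using that unfolding N eigenvalues_def by auto
    then show False
      using F Re by (auto simp: stable_matrix_def)
  qed
  then have "invertible ?N"
    unfolding invertible_left_inverse matrix_left_invertible_ker by blast
  then obtain N' where "?N ** N' = mat 1"
    unfolding invertible_right_inverse by blast
  then have "?N *v (N' *v x) = x"
    by (simp add: matrix_vector_mul_assoc)
  \<comment> \<open>\<open>adj ?N\<close> annihilates \<open>x\<close>, so \<open>x\<close> is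
    orthogonal to the range of \<open>?N\<close>, in which it lies.\<close>
  then have "cinner x x = cinner (adj ?N *v x) (N' *v x)"
    by (simp add: cinner_adj)
  also have "adj ?N *v x = 0"
    by (simp add: adj_diff adj_mult adj_mat mat_vec skew Bx x cnj vector_smult_lneg)
  finally show False
    using x by (simp add: cinner_self)
qed

text \<open>Applying \<open>A - \<i> lam k\<close> removes the coefficient at \<open>k\<close> and
  creates no new one. Induction on the number of nonzero coefficients ends when the image is zero,
  that is, at an eigenvector.\<close>

lemma invariant_eigenvector:
  assumes N: "\<And>x \<mu>. x \<in> N \<Longrightarrow> A *v x - \<mu> *s x \<in> N" and "x \<in> N" "x \<noteq> 0"
  obtains y \<mu> where "y \<in> N" "y \<noteq> 0" "A *v y = \<mu> *s y"
proof -
  define supp where "supp x = {j \<in> I. cinner (v j) x \<noteq> 0}" for x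
  have "x \<in> N \<Longrightarrow> x \<noteq> 0 \<Longrightarrow> \<exists>y \<mu>. y \<in> N \<and> y \<noteq> 0 \<and> A *v y = \<mu> *s y"
  proof (induction "card (supp x)" arbitrary: x rule: less_induct)
    case less
    obtain k where k: "k \<in> supp x"
      using less.prems(2) basis_eqI[of x 0] by (auto simp: supp_def)
    let ?\<mu> = "\<i> * complex_of_real (lam k)"
    let ?y = "A *v x - ?\<mu> *s x"
    have "cinner (v j) ?y = (\<i> * complex_of_real (lam j) - ?\<mu>) * cinner (v j) x" if "j \<in> I" for j
      using that by (simp add: cinner_diff_right cinner_smult_right cinner_basis_A algebra_simps)
    then have "supp ?y \<subseteq> supp x - {k}"
      by (auto simp: supp_def)
    then have lt: "card (supp ?y) < card (supp x)"
      using k finite_I by (intro psubset_card_mono) (auto simp: supp_def)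
    show ?case
    proof (cases "?y = 0")
      case True
      then show ?thesis using less.prems by auto
    next
      case False
      then show ?thesis using less.hyps[OF lt] N less.prems(1) by blast
    qed
  qed
  then show thesis using assms(2,3) that by blast
qed

text \<open>For invertible \<open>X\<close> the Riccati equation says that \<open>Z = X\<inverse>\<close> is a zero of this map.\<close>

definition dual_riccati :: "complex^'n^'n \<Rightarrow> complex^'n^'n" where
  "dual_riccati Z = Z ** Z + A ** Z - Z ** A - B ** adj B"

lemma dual_riccati_vec:
  "dual_riccati Z *v x = Z *v (Z *v x) + A *v (Z *v x) - Z *v (A *v x) - B *v (adj B *v x)"
  by (simp add: dual_riccati_def mat_vec)

section \<open>Existence and uniqueness for the dual Riccati equation\<close>

text \<open>The kernel of \<open>Z\<close> is invariant under \<open>A\<close> and contained in the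
  kernel of \<open>adj B\<close>. If nonzero, it would contain an eigenvector of \<open>A\<close>,
  against \<open>adj_B_eigenvector\<close>. The inequality version is what the minimization over
  \<open>K\<close> below needs.\<close>

lemma psd_imp_pos:
  assumes Z: "psd Z" and E: "psd (dual_riccati Z)" and "x \<noteq> 0"
  shows "x \<bullet> (Z *v x) > 0"
proof (rule ccontr)
  assume "\<not> x \<bullet> (Z *v x) > 0"
  then have "x \<bullet> (Z *v x) = 0"
    using Z by (simp add: psd_def order_antisym not_less)
  then have "Z *v x = 0"
    using Z by (rule psd_null[rotated])
  have adjZ: "adj Z = Z" using Z by (simp add: psd_def)
  \<comment> \<open>On the kernel of \<open>Z\<close> the form of \<open>dual_riccati Z\<close>
    reduces to -|B* y|^2, so being psd forces it to vanish; \<open>psd_null\<close> then leaves Z A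
    y = 0.\<close>
  have ker: "adj B *v y = 0 \<and> Z *v (A *v y) = 0" if y: "Z *v y = 0" for y
  proof -
    have "y \<bullet> (Z *v (A *v y)) = 0"
      by (metis y adjZ inner_adj inner_zero_left)
    then have q: "y \<bullet> (dual_riccati Z *v y) = - ((adj B *v y) \<bullet> (adj B *v y))"
      by (simp add: dual_riccati_vec y inner_diff_right inner_adj)
    then have "(adj B *v y) \<bullet> (adj B *v y) \<le> 0"
      using E unfolding psd_def by (metis neg_0_le_iff_le)
    then have B: "adj B *v y = 0"
      by (metis inner_eq_zero_iff inner_ge_zero order_antisym)
    then have "dual_riccati Z *v y = 0"
      using q E by (intro psd_null) auto
    then show ?thesis
      using B y by (simp add: dual_riccati_vec)
  qed
  obtain y \<mu> where "Z *v y = 0" "y \<noteq> 0" "A *v y = \<mu> *s y"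
    using invariant_eigenvector[of "{y. Z *v y = 0}" x] ker \<open>Z *v x = 0\<close> \<open>x \<noteq> 0\<close>
    by (auto simp: mat_vec)
  then show False
    using ker adj_B_eigenvector by blast
qed

text \<open>The set \<open>K\<close> of supersolutions between 0 and \<open>c\<close> is compact,
  and a point of \<open>K\<close> with least trace \<open>f\<close> is a solution: a Newton step
  stays in \<open>K\<close> and lowers the trace unless the residual is zero.\<close>

lemma dual_riccati_exists: "\<exists>Z. psd Z \<and> dual_riccati Z = 0"
proof -
  define c where "c = onorm ((*v) B)"
  let ?c = "mat (complex_of_real c) :: complex^'n^'n"
  define K where "K = {Z. (psd Z \<and> psd (?c - Z)) \<and> psd (dual_riccati Z)}"
  define f where "f Z = (\<Sum>i\<in>UNIV. axis i 1 \<bullet> (Z *v axis i 1))" for Z :: "complex^'n^'n"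
  have "closed K"
    unfolding K_def dual_riccati_def
    by (intro closed_Collect_conj closed_psd continuous_intros)
  moreover have "bounded K"
    by (rule bounded_subset[OF bounded_psd_le[of c]]) (auto simp: K_def)
  ultimately have "compact K"
    by (simp add: compact_eq_bounded_closed)
  \<comment> \<open>A scalar matrix commutes with \<open>A\<close>, and c^2 - B B* is psd because
    \<open>c\<close> is the operator norm of \<open>B\<close>.\<close>
  moreover have "?c \<in> K"
  proof -
    have "c \<ge> 0" by (simp add: c_def onorm_pos_le)
    have "x \<bullet> (dual_riccati ?c *v x) = (c * norm x)\<^sup>2 - (norm (adj B *v x))\<^sup>2" for x
    proof -
      have "x \<bullet> (dual_riccati ?c *v x) = c * (c * (x \<bullet> x)) - (adj B *v x) \<bullet> (adj B *v x)"
        by (simp add: dual_riccati_vec mat_vec smult_of_real inner_diff_right inner_adj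
            matrix_vec_scaleR)
      then show ?thesis
        by (simp add: power_mult_distrib power2_norm_eq_inner) (simp add: power2_eq_square)
    qed
    moreover have "(norm (adj B *v x))\<^sup>2 \<le> (c * norm x)\<^sup>2" for x
      using norm_adj_vec_le[of B x] by (simp add: c_def power_mono)
    moreover have "adj (dual_riccati ?c) = dual_riccati ?c"
      by (simp add: dual_riccati_def adj_add adj_diff adj_mult adj_mat skew matrix_eq mat_vec
          algebra_simps)
    ultimately have "psd (dual_riccati ?c)"
      by (simp add: psd_def)
    then show ?thesis
      using \<open>c \<ge> 0\<close> by (simp add: K_def psd_def adj_mat mat_vec smult_of_real adj_diff)
  qed
  moreover have "continuous_on K f"
    unfolding f_def by (intro continuous_intros)
  ultimately obtain Z where Z: "Z \<in> K" and min: "\<And>Y. Y \<in> K \<Longrightarrow> f Z \<le> f Y"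
    using continuous_attains_inf[of K f] by auto
  then have psdZ: "psd Z" and le: "psd (?c - Z)" and E: "psd (dual_riccati Z)"
    by (auto simp: K_def)
  have adjZ: "adj Z = Z" using psdZ by (simp add: psd_def)
  \<comment> \<open>The derivative of \<open>dual_riccati\<close> at \<open>Z\<close> is the
    Lyapunov operator of this matrix.\<close>
  let ?G = "Z - A"
  have adjG: "adj ?G = Z + A"
    by (simp add: adj_diff adjZ skew)
  have G: "x \<bullet> (?G *v x) > 0" if "x \<noteq> 0" for x
    using psd_imp_pos[OF psdZ E that] by (simp add: mat_vec inner_diff_right inner_skew_self)
  \<comment> \<open>one step of Newton's method, which does not increase \<open>f\<close>\<close>
  obtain W where W: "adj W = W" "adj ?G ** W + W ** ?G = dual_riccati Z"
    using lyapunov_solution[of ?G "dual_riccati Z"] G E by (auto simp: psd_def)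
  have psdW: "psd W"
    using G W E by (intro lyapunov_psd[of ?G]) (auto simp: psd_def)
  define Y where "Y = Z - W"
  have Wx: "B *v (adj B *v x) = Z *v (Z *v x) + A *v (Z *v x) - Z *v (A *v x)
      - (Z *v (W *v x) + A *v (W *v x) + (W *v (Z *v x) - W *v (A *v x)))" for x
    using arg_cong[OF W(2), of "\<lambda>M. M *v x"]
    by (simp add: adjG mat_vec dual_riccati_vec algebra_simps)
  \<comment> \<open>The map is quadratic, so the residual after the Newton step is exactly the
    second-order term W^2.\<close>
  have "dual_riccati Y = adj W ** W"
    unfolding matrix_eq
    by (intro allI) (simp add: dual_riccati_vec Y_def W(1) mat_vec Wx algebra_simps)
  then have "psd (dual_riccati Y)"
    by (simp add: psd_adj_mult)
  moreover have "psd Y"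
  proof (rule lyapunov_psd[OF G])
    show "adj Y = Y" by (simp add: Y_def adj_diff adjZ W)
    have "adj ?G ** Y + Y ** ?G = adj Z ** Z + adj (adj B) ** adj B"
      unfolding matrix_eq
      by (intro allI) (simp add: adjG adjZ Y_def mat_vec Wx algebra_simps)
    moreover have "psd (adj Z ** Z + adj (adj B) ** adj B)"
      by (intro psd_add psd_adj_mult)
    ultimately show "0 \<le> x \<bullet> ((adj ?G ** Y + Y ** ?G) *v x)" for x
      by (simp add: psd_def)
  qed
  moreover have "psd (?c - Y)"
    using psd_add[OF le psdW] by (simp add: Y_def algebra_simps)
  ultimately have "f Z \<le> f Y"
    by (intro min) (simp add: K_def)
  also have "f Y = f Z - f W"
    by (simp add: f_def Y_def mat_vec inner_diff_right sum_subtractf)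
  finally have "W = 0"
    by (intro psd_eq_0 psdW) (simp add: f_def)
  then have "dual_riccati Z = 0"
    using W(2) by (simp add: matrix_eq mat_vec)
  with psdZ show ?thesis by blast
qed

text \<open>Twice the difference of the two equations is a Lyapunov equation for
  \<open>Z - Y\<close>: with the symmetric choice of \<open>G\<close> the mixed products of
  \<open>Z\<close> and \<open>Y\<close> cancel.\<close>

lemma dual_riccati_unique:
  assumes Z: "psd Z" "dual_riccati Z = 0" and Y: "psd Y" "dual_riccati Y = 0"
  shows "Z = Y"
proof -
  define G where "G = (Z - A) + (Y - A)"
  let ?D = "Z - Y"
  have adj: "adj Z = Z" "adj Y = Y" using Z Y by (auto simp: psd_def)
  have G: "G *v x = Z *v x - A *v x + (Y *v x - A *v x)" for x
    unfolding G_def by (simp only: mat_vec)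
  have adjG: "adj G *v x = Z *v x + A *v x + (Y *v x + A *v x)" for x
    unfolding G_def by (simp only: mat_vec adj_add adj_diff adj skew diff_minus_eq_add)
  have "x \<bullet> (G *v x) > 0" if "x \<noteq> 0" for x
  proof -
    have "x \<bullet> (G *v x) = x \<bullet> (Z *v x) + x \<bullet> (Y *v x)"
      by (simp only: G inner_diff_right inner_add_right inner_skew_self diff_zero)
    moreover have "x \<bullet> (Z *v x) > 0" "x \<bullet> (Y *v x) > 0"
      using psd_imp_pos[OF Z(1) _ that] psd_imp_pos[OF Y(1) _ that] Z(2) Y(2) psd_0 by auto
    ultimately show ?thesis by (simp only: add_pos_pos)
  qed
  moreover have "adj G ** ?D + ?D ** G = 0"
  proof -
    have eq: "B *v (adj B *v x) = Z *v (Z *v x) + A *v (Z *v x) - Z *v (A *v x)"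
      "B *v (adj B *v x) = Y *v (Y *v x) + A *v (Y *v x) - Y *v (A *v x)" for x
      using dual_riccati_vec[of Z x] dual_riccati_vec[of Y x] Z(2) Y(2) by simp_all
    show ?thesis
      unfolding matrix_eq
    proof
      fix x
      have "(adj G ** ?D + ?D ** G) *v x = 2 *\<^sub>R (Z *v (Z *v x) + A *v (Z *v x) - Z *v (A *v x)
          - (Y *v (Y *v x) + A *v (Y *v x) - Y *v (A *v x)))"
        by (simp only: mat_vec G adjG scaleR_2) (simp only: algebra_simps)
      also have "\<dots> = 0 *v x"
        by (simp add: eq[symmetric])
      finally show "(adj G ** ?D + ?D ** G) *v x = 0 *v x" .
    qed
  qed
  ultimately have "?D = 0" by (rule lyapunov_unique)
  then show ?thesis by simp
qed

section \<open>From the dual equation to the closed loop\<close>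

text \<open>Up to sign, multiplying on both sides by \<open>X\<close> or by \<open>Z\<close> turns
  one residual into the other.\<close>

lemma riccati_equation_iff_dual:
  assumes XZ: "X ** Z = mat 1" "Z ** X = mat 1"
  shows "riccati_equation A B X \<longleftrightarrow> dual_riccati Z = 0"
proof -
  have [simp]: "X *v (Z *v x) = x" "Z *v (X *v x) = x" for x
    by (simp_all add: matrix_vector_mul_assoc XZ)
  let ?R = "X ** B ** adj B ** X - X ** A - adj A ** X - mat 1"
  have R: "?R = - (X ** dual_riccati Z ** X)"
    by (simp add: matrix_eq mat_vec dual_riccati_vec skew)
  have D: "dual_riccati Z = - (Z ** ?R ** Z)"
    by (simp add: matrix_eq mat_vec dual_riccati_vec skew)
  have "(0 :: complex^'n^'n) ** M = 0" "M ** (0 :: complex^'n^'n) = 0" for M :: "complex^'n^'n"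
    by (simp_all add: matrix_eq mat_vec)
  then show ?thesis
    unfolding riccati_equation_def using R D by (metis add.inverse_neutral)
qed

text \<open>On the kernel of \<open>X\<close> the equation reduces to x = - X A x, and the range of
  the Hermitian matrix \<open>X\<close> is orthogonal to its kernel.\<close>

lemma riccati_invertible:
  assumes X: "psd X" "riccati_equation A B X"
  obtains Z where "X ** Z = mat 1" "Z ** X = mat 1"
proof -
  have adjX: "adj X = X" using X by (simp add: psd_def)
  have "x = 0" if "X *v x = 0" for x
  proof -
    have "(X ** B ** adj B ** X - X ** A - adj A ** X - mat 1) *v x = 0"
      using X(2) by (simp add: riccati_equation_def)
    then have "x = - (X *v (A *v x))"
      using that by (simp add: mat_vec)
    then have "x \<bullet> x = - ((X *v x) \<bullet> (A *v x))"
      by (metis adjX inner_adj inner_minus_right)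
    then show ?thesis using that by simp
  qed
  then have "\<exists>Z. Z ** X = mat 1"
    unfolding matrix_left_invertible_ker by blast
  then show thesis
    using that matrix_left_right_inverse by blast
qed

lemma psd_inverse:
  assumes X: "psd X" and XZ: "X ** Z = mat 1" "Z ** X = mat 1"
  shows "psd Z"
proof -
  have XZv: "X *v (Z *v x) = x" "Z *v (X *v x) = x" for x
    by (simp_all add: matrix_vector_mul_assoc XZ)
  have "adj Z ** X = mat 1"
    using X arg_cong[OF XZ(1), of adj] by (simp add: adj_mult adj_mat psd_def)
  then have "adj Z = Z"
    by (metis XZ(1) matrix_mul_assoc matrix_mul_lid matrix_mul_rid)
  moreover have "0 \<le> x \<bullet> (Z *v x)" for x
    using X XZv(1)[of x] unfolding psd_def by (metis inner_commute)
  ultimately show ?thesis by (simp add: psd_def)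
qed

text \<open>Uniqueness for the dual equation identifies the definite description
  \<open>riccati_solution\<close> with the inverse of \<open>Z\<close>. The dual equation then reads
  (A - B B* X) Z = Z (A - Z), a similarity.\<close>

lemma closed_loop_dual:
  obtains Z where "psd Z" "dual_riccati Z = 0" "\<And>x. x \<noteq> 0 \<Longrightarrow> x \<bullet> (Z *v x) > 0"
    "eigenvalues (closed_loop A B) = eigenvalues (A - Z)"
proof -
  obtain Z where Z: "psd Z" "dual_riccati Z = 0"
    using dual_riccati_exists by blast
  then have pos: "x \<bullet> (Z *v x) > 0" if "x \<noteq> 0" for x
    using that psd_0 by (intro psd_imp_pos) auto
  then have "x = 0" if "Z *v x = 0" for x
    using that by (metis inner_zero_right less_irrefl)
  then have "\<exists>X. X ** Z = mat 1"
    unfolding matrix_left_invertible_ker by blast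
  then obtain X where XZ: "X ** Z = mat 1" "Z ** X = mat 1"
    using matrix_left_right_inverse by blast
  have XZv: "X *v (Z *v x) = x" "Z *v (X *v x) = x" for x
    by (simp_all add: matrix_vector_mul_assoc XZ)
  have "riccati_solution A B = X"
    unfolding riccati_solution_def hermitian_nonneg_iff_psd
  proof (rule the_equality)
    show "psd X \<and> riccati_equation A B X"
      using psd_inverse[OF Z(1) XZ(2,1)] riccati_equation_iff_dual[OF XZ] Z(2) by blast
    fix X' assume X': "psd X' \<and> riccati_equation A B X'"
    then obtain Z' where Z': "X' ** Z' = mat 1" "Z' ** X' = mat 1"
      using riccati_invertible by blast
    then have "Z' = Z"
      using X' Z riccati_equation_iff_dual[OF Z'] psd_inverse[OF _ Z'] dual_riccati_unique by blast
    then show "X' = X"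
      using Z' XZ by (metis matrix_mul_assoc matrix_mul_lid matrix_mul_rid)
  qed
  then have cl: "closed_loop A B *v (Z *v y) = Z *v ((A - Z) *v y)" for y
    using dual_riccati_vec[of Z y] Z(2)
    by (simp add: closed_loop_def mat_vec XZv algebra_simps)
  have "eigenvalues (closed_loop A B) = eigenvalues (A - Z)"
  proof (intro equalityI subsetI)
    fix s assume "s \<in> eigenvalues (closed_loop A B)"
    then obtain x where x: "x \<noteq> 0" "closed_loop A B *v x = s *s x"
      by (auto simp: eigenvalues_def)
    then have "(A - Z) *v (X *v x) = s *s (X *v x)"
      using cl[of "X *v x"] by (metis XZv matrix_vec_smult)
    moreover have "X *v x \<noteq> 0"
      using x XZv(2)[of x] by auto
    ultimately show "s \<in> eigenvalues (A - Z)"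
      unfolding eigenvalues_def by blast
  next
    fix s assume "s \<in> eigenvalues (A - Z)"
    then obtain y where y: "y \<noteq> 0" "(A - Z) *v y = s *s y"
      by (auto simp: eigenvalues_def)
    then have "closed_loop A B *v (Z *v y) = s *s (Z *v y)"
      by (simp add: cl matrix_vec_smult)
    moreover have "Z *v y \<noteq> 0"
      using y XZv(1)[of y] by auto
    ultimately show "s \<in> eigenvalues (closed_loop A B)"
      unfolding eigenvalues_def by blast
  qed
  with that Z pos show thesis by blast
qed

text \<open>The factorization \<open>(A - s)\<^sup>2 - B B\<^sup>* = (Z + A - s) (A - Z - s)\<close>, whose first factor is
  injective for \<open>Re s < 0\<close>.\<close>

lemma eigenvalues_closed_loop_iff:
  "s \<in> eigenvalues (closed_loop A B) \<longleftrightarrow> Re s < 0 \<and>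
    (\<exists>y. y \<noteq> 0 \<and> (\<forall>j\<in>I. (\<i> * complex_of_real (lam j) - s)\<^sup>2 * cinner (v j) y
      = cinner (v j) (B *v (adj B *v y))))"
proof -
  obtain Z where Z: "dual_riccati Z = 0" "\<And>x. x \<noteq> 0 \<Longrightarrow> x \<bullet> (Z *v x) > 0"
    and ev: "eigenvalues (closed_loop A B) = eigenvalues (A - Z)"
    using closed_loop_dual by metis
  have BB: "B *v (adj B *v x) = Z *v (Z *v x) + A *v (Z *v x) - Z *v (A *v x)" for x
    using dual_riccati_vec[of Z x] Z(1) by simp
  define P where "P x = A *v x - s *s x" for x
  have PB: "P (P y) - B *v (adj B *v y) = Z *v (P y - Z *v y) + P (P y - Z *v y)" for y
    by (simp add: P_def BB mat_vec algebra_simps)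
  have P0: "P 0 = 0"
    by (simp add: P_def)
  have PP: "(\<forall>j\<in>I. (\<i> * complex_of_real (lam j) - s)\<^sup>2 * cinner (v j) y
      = cinner (v j) (B *v (adj B *v y))) \<longleftrightarrow> P (P y) = B *v (adj B *v y)" for y
  proof -
    have "cinner (v j) (P x) = (\<i> * complex_of_real (lam j) - s) * cinner (v j) x"
      if "j \<in> I" for j x
      using that by (simp add: P_def cinner_diff_right cinner_smult_right cinner_basis_A
          left_diff_distrib)
    then have "(\<i> * complex_of_real (lam j) - s)\<^sup>2 * cinner (v j) y = cinner (v j) (P (P y))"
      if "j \<in> I" for j
      using that by (simp add: power2_eq_square)
    then show ?thesis
      using basis_eqI[of "P (P y)" "B *v (adj B *v y)"] by auto
  qed
  have reP: "x \<bullet> P x = - Re s * (norm x)\<^sup>2" for x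
  proof -
    have "x \<bullet> (s *s x) = Re (s * cinner x x)"
      by (simp add: Re_cinner[symmetric] cinner_smult_right)
    then show ?thesis
      by (simp add: P_def inner_diff_right inner_skew_self cinner_self)
  qed
  have inj: "x = 0" if "Re s < 0" "Z *v x + P x = 0" for x
  proof (rule ccontr)
    assume "x \<noteq> 0"
    then have "x \<bullet> (Z *v x + P x) > 0"
      using Z(2)[of x] mult_neg_pos[OF that(1), of "(norm x)\<^sup>2"]
      by (simp add: inner_add_right reP)
    then show False using that(2) by simp
  qed
  have fac: "(A - Z) *v y = s *s y \<longleftrightarrow> P y - Z *v y = 0" for y
  proof -
    have eq: "P y - Z *v y = (A - Z) *v y - s *s y"
      by (simp add: P_def mat_vec)
    show ?thesis unfolding eq right_minus_eq ..
  qed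
  \<comment> \<open>Eigenvalues of \<open>A - Z\<close> lie in the open left half-plane because the
    form of \<open>Z\<close> is positive.\<close>
  have neg: "Re s < 0" if "y \<noteq> 0" "P y - Z *v y = 0" for y
  proof -
    have "y \<bullet> (Z *v y) = - Re s * (norm y)\<^sup>2"
      using that(2) reP[of y] by simp
    then show ?thesis
      using Z(2)[OF that(1)] that(1) by (simp add: mult_less_0_iff)
  qed
  have "(\<exists>y. y \<noteq> 0 \<and> P y - Z *v y = 0) \<longleftrightarrow>
      Re s < 0 \<and> (\<exists>y. y \<noteq> 0 \<and> P (P y) = B *v (adj B *v y))"
  proof (intro iffI)
    assume "\<exists>y. y \<noteq> 0 \<and> P y - Z *v y = 0"
    then obtain y where y: "y \<noteq> 0" "P y - Z *v y = 0" by blast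
    have "P (P y) = B *v (adj B *v y)"
    proof -
      have "P (P y) - B *v (adj B *v y) = 0"
        unfolding PB y(2) P0 by simp
      then show ?thesis by (rule eq_iff_diff_eq_0[THEN iffD2])
    qed
    with y(1) neg[OF y] show "Re s < 0 \<and> (\<exists>y. y \<noteq> 0 \<and> P (P y) = B *v (adj B *v y))"
      by blast
  next
    assume R: "Re s < 0 \<and> (\<exists>y. y \<noteq> 0 \<and> P (P y) = B *v (adj B *v y))"
    then obtain y where y: "y \<noteq> 0" "P (P y) = B *v (adj B *v y)" by blast
    have "Re s < 0" using R ..
    moreover have "Z *v (P y - Z *v y) + P (P y - Z *v y) = 0"
      unfolding PB[symmetric] y(2) by (rule diff_self)
    ultimately have "P y - Z *v y = 0"
      by (rule inj)
    then show "\<exists>y. y \<noteq> 0 \<and> P y - Z *v y = 0"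
      using y by blast
  qed
  then show ?thesis
    unfolding ev PP by (simp only: eigenvalues_def mem_Collect_eq fac)
qed

end

section \<open>Localization of the closed-loop eigenvalues\<close>

text \<open>All four estimates follow from one inequality in \<open>t\<close>, \<open>d\<close> and
  \<open>\<beta>\<close>, obtained by eliminating the norm of \<open>u\<close> between the squared
  hypothesis and Cauchy-Schwarz for \<open>cinner b u\<close>.\<close>

lemma quadratic_localization:
  fixes b u :: "complex^'m"
  assumes \<rho>: "0 \<le> \<rho>" "\<rho> < 1" and le: "norm (b - u) \<le> \<rho> * norm u"
    and \<mu>: "cinner b u = \<mu>\<^sup>2" and "b \<noteq> 0"
  shows "(norm b)\<^sup>2 \<le> (1 + \<rho>) * (Re \<mu>)\<^sup>2"
    and "(1 - \<rho>) * (Re \<mu>)\<^sup>2 \<le> (norm b)\<^sup>2"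
    and "4 * (1 - \<rho>\<^sup>2) * (Im \<mu>)\<^sup>2 \<le> \<rho>\<^sup>2 * (norm b)\<^sup>2"
    and "0 < Re (\<mu>\<^sup>2)"
proof -
  define t d k \<beta> U where "t = (Re \<mu>)\<^sup>2" and "d = (Im \<mu>)\<^sup>2" and "k = 1 - \<rho>\<^sup>2"
    and "\<beta> = (norm b)\<^sup>2" and "U = (norm u)\<^sup>2"
  have "0 \<le> t" "0 \<le> d" "0 < \<beta>" "0 \<le> U"
    using \<open>b \<noteq> 0\<close> by (simp_all add: t_def d_def \<beta>_def U_def)
  have "0 < k"
    using \<rho> by (simp add: k_def abs_square_less_1)
  have re: "b \<bullet> u = t - d"
    using \<mu> by (simp add: Re_cinner[symmetric] Re_power2 t_def d_def)
  have "(norm (b - u))\<^sup>2 \<le> (\<rho> * norm u)\<^sup>2"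
    using le by (intro power_mono) auto
  then have 1: "\<beta> - 2 * (t - d) + k * U \<le> 0"
    by (simp add: k_def \<beta>_def U_def re[symmetric] power_mult_distrib power2_norm_eq_inner
        inner_diff_left inner_diff_right inner_commute algebra_simps)
  have "t + d \<le> norm b * norm u"
    using norm_cinner_le[of b u] by (simp add: \<mu> norm_power cmod_power2 t_def d_def)
  then have "(t + d)\<^sup>2 \<le> (norm b * norm u)\<^sup>2"
    using \<open>0 \<le> t\<close> \<open>0 \<le> d\<close> by (intro power_mono) auto
  then have "k * (t + d)\<^sup>2 \<le> k * (\<beta> * U)"
    using \<open>0 < k\<close> by (simp add: \<beta>_def U_def power_mult_distrib)
  moreover have "\<beta> * (\<beta> - 2 * (t - d) + k * U) \<le> 0"
    using 1 \<open>0 < \<beta>\<close> by (simp add: mult_le_0_iff)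
  ultimately have 2: "\<beta>\<^sup>2 + k * (t + d)\<^sup>2 \<le> 2 * \<beta> * (t - d)"
    by (simp add: algebra_simps power2_eq_square)
  have "k * t\<^sup>2 \<le> k * (t + d)\<^sup>2"
    using \<open>0 \<le> t\<close> \<open>0 \<le> d\<close> \<open>0 < k\<close> by (intro mult_left_mono power_mono) auto
  moreover have "0 \<le> \<beta> * d"
    using \<open>0 \<le> d\<close> \<open>0 < \<beta>\<close> by simp
  \<comment> \<open>Discarding \<open>d\<close> leaves \<beta>^2 + k t^2 \<le> 2 \<beta> t, which is
    this inequality since k = 1 - \<rho>^2.\<close>
  ultimately have "(\<beta> - t)\<^sup>2 \<le> (\<rho> * t)\<^sup>2"
    using 2 by (simp add: k_def algebra_simps power2_eq_square)
  then have "\<bar>\<beta> - t\<bar> \<le> \<rho> * t"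
    using \<rho> \<open>0 \<le> t\<close> by (metis abs_le_square_iff abs_of_nonneg mult_nonneg_nonneg)
  then show "(norm b)\<^sup>2 \<le> (1 + \<rho>) * (Re \<mu>)\<^sup>2" "(1 - \<rho>) * (Re \<mu>)\<^sup>2 \<le> (norm b)\<^sup>2"
    unfolding t_def[symmetric] \<beta>_def[symmetric] by (auto simp: algebra_simps)
  \<comment> \<open>This square bounds k^2 (t + d)^2 below by 2 k \<beta> (t + d) - \<beta>^2; the
    terms in \<open>t\<close> then cancel and a bound on \<open>d\<close> remains.\<close>
  have "0 \<le> (\<beta> - k * (t + d))\<^sup>2" by simp
  moreover have "k * (\<beta>\<^sup>2 + k * (t + d)\<^sup>2) \<le> k * (2 * \<beta> * (t - d))"
    using 2 \<open>0 < k\<close> by (intro mult_left_mono) auto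
  ultimately have "(4 * k * d) * \<beta> \<le> (\<rho>\<^sup>2 * \<beta>) * \<beta>"
    by (simp add: k_def algebra_simps power2_eq_square)
  then show "4 * (1 - \<rho>\<^sup>2) * (Im \<mu>)\<^sup>2 \<le> \<rho>\<^sup>2 * (norm b)\<^sup>2"
    using \<open>0 < \<beta>\<close> by (simp add: k_def d_def \<beta>_def)
  have "0 < \<beta>\<^sup>2 + k * (t + d)\<^sup>2"
    using \<open>0 < \<beta>\<close> \<open>0 < k\<close> by (intro add_pos_nonneg) auto
  then have "0 < 2 * \<beta> * (t - d)" using 2 by linarith
  then show "0 < Re (\<mu>\<^sup>2)"
    using \<open>0 < \<beta>\<close> by (simp add: t_def d_def Re_power2 zero_less_mult_iff)
qed

context regulator
begin

section \<open>Reduction to a single index\<close>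

text \<open>For nonzero \<open>D j\<close> this inverts multiplication of the coefficients by
  \<open>D j\<close> on the span of the \<open>v j\<close> with \<open>j\<close> in
  \<open>J\<close>; the other coefficients are sent to 0.\<close>

definition diag_div :: "nat set \<Rightarrow> (nat \<Rightarrow> complex) \<Rightarrow> complex^'n \<Rightarrow> complex^'n" where
  "diag_div J D x = (\<Sum>j\<in>J. (cinner (v j) x / D j) *s v j)"

lemma norm_diag_div_le:
  assumes "J \<subseteq> I" "0 < r" and D: "\<And>j. j \<in> J \<Longrightarrow> r \<le> cmod (D j)"
  shows "norm (diag_div J D x) \<le> norm x / r"
proof -
  have "(norm (diag_div J D x))\<^sup>2
      = (\<Sum>j\<in>I. if j \<in> J then (cmod (cinner (v j) x) / cmod (D j))\<^sup>2 else 0)"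
    unfolding parseval diag_div_def
    by (intro sum.cong) (use assms(1) in \<open>auto simp: cinner_basis_sum norm_divide\<close>)
  also have "\<dots> \<le> (\<Sum>j\<in>I. (cmod (cinner (v j) x) / r)\<^sup>2)"
    using D \<open>0 < r\<close> by (intro sum_mono) (auto intro!: power_mono divide_left_mono mult_pos_pos
        intro: less_le_trans)
  also have "\<dots> = (norm x / r)\<^sup>2"
    by (simp add: parseval power_divide sum_divide_distrib)
  finally show ?thesis
    using \<open>0 < r\<close> by (simp add: power2_le_iff_abs_le)
qed

text \<open>The operator \<open>R\<close> of the introduction; the spectral parameter enters only
  through \<open>D\<close>.\<close>

definition remainder :: "nat \<Rightarrow> (nat \<Rightarrow> complex) \<Rightarrow> complex^'m \<Rightarrow> complex^'m" where
  "remainder k D w = adj B *v diag_div (I - {k}) D (B *v w)"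

lemma norm_remainder_le:
  assumes "0 < r" and D: "\<And>j. j \<in> I - {k} \<Longrightarrow> r \<le> cmod (D j)"
  shows "norm (remainder k D w) \<le> (onorm ((*v) B))\<^sup>2 / r * norm w"
proof -
  let ?c = "onorm ((*v) B)"
  have "0 \<le> ?c" by (simp add: onorm_pos_le)
  have "norm (remainder k D w) \<le> ?c * norm (diag_div (I - {k}) D (B *v w))"
    unfolding remainder_def by (rule norm_adj_vec_le)
  also have "\<dots> \<le> ?c * (norm (B *v w) / r)"
    using norm_diag_div_le[of "I - {k}" r D] assms \<open>0 \<le> ?c\<close> by (intro mult_left_mono) auto
  also have "\<dots> \<le> ?c * (?c * norm w / r)"
    using \<open>0 \<le> ?c\<close> \<open>0 < r\<close> by (intro mult_left_mono divide_right_mono norm_matrix_vec_le) auto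
  finally show ?thesis by (simp add: power2_eq_square)
qed

text \<open>Dividing the coefficient equations by \<open>D j\<close> and applying
  \<open>adj B\<close> gives a closed equation for \<open>w = adj B *v y\<close>, in which the term
  with index \<open>k\<close> is a multiple of \<open>b\<close>.\<close>

lemma eigenvalue_near:
  assumes s: "s \<in> eigenvalues (closed_loop A B)" and k: "k \<in> I" and "0 < h"
    and gap: "\<And>j. j \<in> I - {k} \<Longrightarrow> h \<le> \<bar>lam j - Im s\<bar>"
    and \<rho>: "\<rho> = (onorm ((*v) B))\<^sup>2 / h\<^sup>2" "\<rho> < 1"
  obtains u where "norm (adj B *v v k - u) \<le> \<rho> * norm u"
    "cinner (adj B *v v k) u = (\<i> * complex_of_real (lam k) - s)\<^sup>2"
proof -
  define \<mu> where "\<mu> j = \<i> * complex_of_real (lam j) - s" for j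
  define D where "D j = (\<mu> j)\<^sup>2" for j
  define b where "b = adj B *v v k"
  obtain y where "Re s < 0" "y \<noteq> 0"
    and y: "\<And>j. j \<in> I \<Longrightarrow> D j * cinner (v j) y = cinner (v j) (B *v (adj B *v y))"
    using s unfolding eigenvalues_closed_loop_iff D_def \<mu>_def by blast
  have "\<mu> j \<noteq> 0" for j
    using \<open>Re s < 0\<close> by (auto simp: \<mu>_def complex_eq_iff)
  then have D0: "D j \<noteq> 0" for j by (simp add: D_def)
  define w where "w = adj B *v y"
  define \<alpha> where "\<alpha> = cinner b w"
  have yj: "cinner (v j) y = cinner (v j) (B *v w) / D j" if "j \<in> I" for j
    using y[OF that] D0[of j] by (simp add: w_def field_simps)
  have "y = (\<Sum>j\<in>I. (cinner (v j) (B *v w) / D j) *s v j)"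
    by (subst expansion) (simp add: yj)
  also have "\<dots> = (\<alpha> / D k) *s v k + diag_div (I - {k}) D (B *v w)"
    using k finite_I by (simp add: sum.remove diag_div_def \<alpha>_def b_def cinner_adj)
  finally have w: "w = (\<alpha> / D k) *s b + remainder k D w"
    by (subst w_def) (simp add: mat_vec remainder_def b_def)
  have "h\<^sup>2 \<le> cmod (D j)" if "j \<in> I - {k}" for j
  proof -
    have "h \<le> cmod (\<mu> j)"
      using gap[OF that] abs_Im_le_cmod[of "\<mu> j"] by (simp add: \<mu>_def)
    then show ?thesis
      using \<open>0 < h\<close> by (simp add: D_def norm_power power_mono)
  qed
  then have R: "norm (remainder k D w) \<le> \<rho> * norm w"
    using norm_remainder_le[of "h\<^sup>2" k D w] \<open>0 < h\<close> by (simp add: \<rho>)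
  \<comment> \<open>Otherwise \<open>w\<close> would be a fixed point of the contraction
    \<open>remainder k D\<close>, and the whole vector \<open>y\<close> would vanish.\<close>
  have "\<alpha> \<noteq> 0"
  proof
    assume "\<alpha> = 0"
    then have "norm w \<le> \<rho> * norm w"
      using w R by simp
    then have "w = 0"
      using \<rho>(2) by (simp add: mult_le_cancel_right1)
    then have "y = 0"
      using basis_eqI[of y 0] yj by simp
    with \<open>y \<noteq> 0\<close> show False ..
  qed
  \<comment> \<open>This scaling gives \<open>b\<close> the coefficient 1 and makes
    \<open>cinner b u\<close> equal to \<open>D k\<close>.\<close>
  define u where "u = (D k / \<alpha>) *s w"
  have "u = b + (D k / \<alpha>) *s remainder k D w"
    unfolding u_def by (subst w) (simp add: vector_add_ldistrib vector_smult_assoc D0 \<open>\<alpha> \<noteq> 0\<close>)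
  then have "norm (b - u) = cmod (D k / \<alpha>) * norm (remainder k D w)"
    by (simp add: norm_smult)
  also have "\<dots> \<le> cmod (D k / \<alpha>) * (\<rho> * norm w)"
    by (intro mult_left_mono R) simp
  also have "\<dots> = \<rho> * norm u"
    by (simp add: u_def norm_smult)
  finally have "norm (b - u) \<le> \<rho> * norm u" .
  moreover have "cinner b u = D k"
    using \<open>\<alpha> \<noteq> 0\<close> by (simp add: u_def cinner_smult_right \<alpha>_def[symmetric])
  ultimately show thesis
    using that by (simp add: b_def D_def \<mu>_def)
qed

lemma norm_basis: "k \<in> I \<Longrightarrow> norm (v k) = 1"
proof -
  assume "k \<in> I"
  then have "complex_of_real ((norm (v k))\<^sup>2) = complex_of_real 1"
    by (simp only: cinner_self[symmetric] orthonormal of_real_1 if_True simp_thms)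
  then show ?thesis
    unfolding of_real_eq_iff power2_eq_1_iff using norm_ge_zero[of "v k"] by linarith
qed

lemma adj_B_basis: "k \<in> I \<Longrightarrow> adj B *v v k \<noteq> 0"
  using norm_basis[of k] by (intro adj_B_eigenvector[OF _ eigen]) auto

text \<open>The argument of \<open>eigenvalue_near\<close> is run backwards: with
  \<open>s = \<i> lam k - p\<close>, a \<open>p\<close> with p^2 = \<open>cinner b (u p)\<close>
  yields an eigenvector.\<close>

lemma eigenvalue_exists:
  assumes k: "k \<in> I" and "0 < h"
    and gap: "\<And>j. j \<in> I - {k} \<Longrightarrow> 2 * h \<le> \<bar>lam j - lam k\<bar>"
    and \<rho>: "\<rho> = (onorm ((*v) B))\<^sup>2 / h\<^sup>2" "\<rho> < 3/4"
  obtains s where "s \<in> eigenvalues (closed_loop A B)"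
    "(1 - \<rho>) * (Re s)\<^sup>2 \<le> (norm (adj B *v v k))\<^sup>2"
proof -
  define b where "b = adj B *v v k"
  have "b \<noteq> 0" using adj_B_basis[OF k] by (simp add: b_def)
  have "0 \<le> \<rho>" by (simp add: \<rho>)
  define D where "D p j = (\<i> * complex_of_real (lam j - lam k) + p)\<^sup>2" for p j
  define C where "C = sqrt ((norm b)\<^sup>2 / (1 - \<rho>))"
  \<comment> \<open>The height \<open>h\<close> keeps every other frequency at distance at least
    \<open>h\<close>, and \<open>C\<close> is the second bound of
    \<open>quadratic_localization\<close>.\<close>
  define K where "K = cbox (Complex 0 (- h)) (Complex C h)"
  have "0 \<le> C" using \<rho>(2) by (simp add: C_def)
  have K: "p \<in> K \<longleftrightarrow> 0 \<le> Re p \<and> Re p \<le> C \<and> \<bar>Im p\<bar> \<le> h" for p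
    by (auto simp: K_def in_cbox_complex_iff)
  have Dge: "h\<^sup>2 \<le> cmod (D p j)" if "p \<in> K" "j \<in> I - {k}" for p j
  proof -
    have "h \<le> cmod (\<i> * complex_of_real (lam j - lam k) + p)"
      using gap[OF that(2)] that(1) abs_Im_le_cmod[of "\<i> * complex_of_real (lam j - lam k) + p"]
      by (auto simp: K)
    then show ?thesis
      using \<open>0 < h\<close> by (simp add: D_def norm_power power_mono)
  qed
  have R: "norm (remainder k (D p) w) \<le> \<rho> * norm w" if "p \<in> K" for p w
    using norm_remainder_le[of "h\<^sup>2" k "D p" w] Dge[OF that] \<open>0 < h\<close> by (simp add: \<rho>)
  have lin: "linear (remainder k (D p))" for p
  proof (rule linearI)
    fix x y and r :: real
    show "remainder k (D p) (x + y) = remainder k (D p) x + remainder k (D p) y"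
      by (simp add: remainder_def diag_div_def mat_vec cinner_add_right add_divide_distrib
          vec.scale_left_distrib sum.distrib)
    have "diag_div (I - {k}) (D p) (r *\<^sub>R (B *v x)) = r *\<^sub>R diag_div (I - {k}) (D p) (B *v x)"
      by (simp add: diag_div_def smult_of_real[symmetric] cinner_smult_right vec.scale_sum_right
          vector_smult_assoc)
    then show "remainder k (D p) (r *\<^sub>R x) = r *\<^sub>R remainder k (D p) x"
      by (simp add: remainder_def matrix_vec_scaleR)
  qed
  have coercive: "(1 - \<rho>) * norm w \<le> norm (w - remainder k (D p) w)" if "p \<in> K" for p w
    using R[OF that, of w] norm_triangle_ineq2[of w "remainder k (D p) w"]
    by (simp add: algebra_simps)
  have "\<exists>u. u - remainder k (D p) u = b" if p: "p \<in> K" for p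
  proof -
    define N where "N u = u - remainder k (D p) u" for u
    have "linear N"
      unfolding N_def using lin by (intro linear_compose_sub linear_ident)
    moreover have "u = 0" if "N u = 0" for u
    proof -
      have "(1 - \<rho>) * norm u \<le> 0"
        using coercive[OF p, of u] that by (simp add: N_def)
      then show ?thesis using \<rho>(2) by (simp add: mult_le_0_iff)
    qed
    ultimately have "inj N"
      by (metis linear_injective_0)
    with \<open>linear N\<close> have "surj N"
      by (rule eucl.linear_inj_imp_surj)
    then have "\<exists>u. N u = b"
      by (metis surjD)
    then show ?thesis by (simp only: N_def)
  qed
  then have "\<forall>p\<in>K. \<exists>u. u - remainder k (D p) u = b" by blast
  from bchoice[OF this] obtain u where u: "\<And>p. p \<in> K \<Longrightarrow> u p - remainder k (D p) (u p) = b"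
    by blast
  have cont: "continuous_on K u"
    unfolding continuous_on_def
  proof
    fix q assume q: "q \<in> K"
    have "continuous_on K (\<lambda>p. remainder k (D p) (u q))"
    proof -
      have "D p j \<noteq> 0" if "p \<in> K" "j \<in> I - {k}" for p j
        using Dge[OF that] \<open>0 < h\<close> by auto
      then show ?thesis
        unfolding remainder_def diag_div_def vector_scalar_mult_def D_def
        by (intro continuous_intros) auto
    qed
    then have "((\<lambda>p. remainder k (D p) (u q) - remainder k (D q) (u q)) \<longlongrightarrow> 0) (at q within K)"
      using q unfolding continuous_on_def by (intro LIM_zero) blast
    then have lim: "((\<lambda>p. norm (remainder k (D p) (u q) - remainder k (D q) (u q)) / (1 - \<rho>))
        \<longlongrightarrow> 0) (at q within K)"
      by (intro tendsto_divide_zero tendsto_norm_zero)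
    \<comment> \<open>(1 - R(p)) (u p - u q) = (R(p) - R(q)) u q, and \<open>1 - R(p)\<close> is
      bounded below by \<open>1 - \<rho>\<close>.\<close>
    have "norm (u p - u q) \<le> norm (remainder k (D p) (u q) - remainder k (D q) (u q)) / (1 - \<rho>)"
      if p: "p \<in> K" for p
    proof -
      have eq: "(u p - u q) - remainder k (D p) (u p - u q)
          = remainder k (D p) (u q) - remainder k (D q) (u q)"
      proof -
        have "(u p - u q) - remainder k (D p) (u p - u q)
            = (u p - remainder k (D p) (u p)) - (u q - remainder k (D q) (u q))
              + (remainder k (D p) (u q) - remainder k (D q) (u q))"
          by (simp add: linear_diff[OF lin])
        then show ?thesis
          unfolding u[OF p] u[OF q] by simp
      qed
      show ?thesis
        using coercive[OF p, of "u p - u q"] \<rho>(2) unfolding eq by (simp add: field_simps)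
    qed
    then have "((\<lambda>p. u p - u q) \<longlongrightarrow> 0) (at q within K)"
      by (intro Lim_null_comparison[OF _ lim]) (simp add: eventually_at_filter)
    then show "(u \<longlongrightarrow> u q) (at q within K)"
      by (rule LIM_zero_cancel)
  qed
  define f where "f p = csqrt (cinner b (u p))" for p
  have near: "norm (b - u p) \<le> \<rho> * norm (u p)" if "p \<in> K" for p
    using R[OF that, of "u p"] unfolding u[OF that, symmetric] by simp
  have f2: "cinner b (u p) = (f p)\<^sup>2" for p
    by (simp add: f_def)
  have "\<rho> < 1" using \<rho>(2) by simp
  note loc = quadratic_localization[OF \<open>0 \<le> \<rho>\<close> \<open>\<rho> < 1\<close> near f2 \<open>b \<noteq> 0\<close>]
  \<comment> \<open>The last estimate of \<open>quadratic_localization\<close> keeps the argument of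
    \<open>csqrt\<close> in the right half-plane, off the branch cut.\<close>
  have "continuous_on K f"
    unfolding f_def
  proof (rule continuous_on_compose2[OF continuous_on_csqrt])
    show "continuous_on K (\<lambda>p. cinner b (u p))"
      unfolding cinner_def by (intro continuous_intros cont)
    show "(\<lambda>p. cinner b (u p)) ` K \<subseteq> - \<real>\<^sub>\<le>\<^sub>0"
      using loc(4) by (auto simp: f2 complex_nonpos_Reals_iff dest!: leD)
  qed
  moreover have "f \<in> K \<rightarrow> K"
  proof
    fix p assume p: "p \<in> K"
    have "0 \<le> Re (f p)"
      using csqrt_principal[of "cinner b (u p)"] unfolding f_def by linarith
    moreover have "Re (f p) \<le> C"
      unfolding C_def using loc(2)[OF p] \<open>\<rho> < 1\<close> by (intro real_le_rsqrt) (simp add: field_simps)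
    \<comment> \<open>Here \<rho> < 3/4 enters: it gives |b|^2 \<le> \<rho> h^2 \<le> (3/4) h^2,
      \<rho>^2 \<le> 9/16 and 4 (1 - \<rho>^2) \<ge> 1.\<close>
    moreover have "(Im (f p))\<^sup>2 \<le> h\<^sup>2"
    proof -
      have r2: "\<rho>\<^sup>2 \<le> 9/16"
        using power_mono[of \<rho> "3/4" 2] \<rho> \<open>0 \<le> \<rho>\<close> by (simp add: power2_eq_square)
      have "norm b \<le> onorm ((*v) B)"
        using norm_adj_vec_le[of B "v k"] norm_basis[OF k] by (simp add: b_def)
      then have "(norm b)\<^sup>2 \<le> \<rho> * h\<^sup>2"
        using \<open>0 < h\<close> by (simp add: \<rho> power_mono)
      also have "\<dots> \<le> 3/4 * h\<^sup>2"
        using \<rho> by (intro mult_right_mono) auto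
      finally have "\<rho>\<^sup>2 * (norm b)\<^sup>2 \<le> 9/16 * (3/4 * h\<^sup>2)"
        using r2 by (intro mult_mono) auto
      then have "4 * (1 - \<rho>\<^sup>2) * (Im (f p))\<^sup>2 \<le> 27/64 * h\<^sup>2"
        using loc(3)[OF p] by simp
      moreover have "1 * (Im (f p))\<^sup>2 \<le> 4 * (1 - \<rho>\<^sup>2) * (Im (f p))\<^sup>2"
        using r2 by (intro mult_right_mono) auto
      moreover have "27/64 * h\<^sup>2 \<le> h\<^sup>2" by simp
      ultimately show ?thesis by linarith
    qed
    then have "\<bar>Im (f p)\<bar> \<le> h"
      using \<open>0 < h\<close> by (simp add: abs_le_square_iff[symmetric])
    ultimately show "f p \<in> K"
      by (simp add: K)
  qed
  moreover have "0 \<in> K"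
    using \<open>0 < h\<close> \<open>0 \<le> C\<close> by (simp add: K)
  then have "K \<noteq> {}" by blast
  moreover have "compact K" "convex K" by (simp_all add: K_def)
  ultimately obtain p where p: "p \<in> K" "f p = p"
    using brouwer[of K f] by blast
  define s where "s = \<i> * complex_of_real (lam k) - p"
  have s: "D p j = (\<i> * complex_of_real (lam j) - s)\<^sup>2" for j
    by (simp add: D_def s_def algebra_simps)
  \<comment> \<open>Since the real part of p^2 is positive, \<open>p\<close> is off the imaginary
    axis.\<close>
  have "Re p > 0"
  proof -
    have "Re p \<noteq> 0"
      using loc(4)[OF p(1)] p(2) by (auto simp: Re_power2)
    then show ?thesis using p(1) by (simp add: K)
  qed
  then have "\<i> * complex_of_real (lam j) - s \<noteq> 0" for j
    by (auto simp: s_def complex_eq_iff)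
  then have D0: "D p j \<noteq> 0" for j by (simp add: s)
  define y where "y = (\<Sum>j\<in>I. (cinner (v j) (B *v u p) / D p j) *s v j)"
  \<comment> \<open>The fixed-point equation, as \<open>D p k\<close> is p^2; it gives
    \<open>y\<close> the coefficient 1 at \<open>v k\<close>.\<close>
  have "cinner (v k) (B *v u p) = D p k"
    using f2[of p] p(2) by (simp add: b_def cinner_adj D_def)
  then have "y = v k + diag_div (I - {k}) (D p) (B *v u p)"
    using k finite_I D0[of k] by (simp add: y_def sum.remove diag_div_def)
  then have "adj B *v y = b + remainder k (D p) (u p)"
    by (simp add: mat_vec b_def remainder_def)
  then have By: "adj B *v y = u p"
    using u[OF p(1)] by (simp add: algebra_simps)
  have "u p \<noteq> 0"
    using near[OF p(1)] \<open>b \<noteq> 0\<close> by auto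
  then have "y \<noteq> 0"
    using By by auto
  moreover have "D p j * cinner (v j) y = cinner (v j) (B *v (adj B *v y))" if "j \<in> I" for j
  proof -
    have "cinner (v j) y = cinner (v j) (B *v u p) / D p j"
      unfolding y_def using that by (simp add: cinner_basis_sum)
    then show ?thesis by (simp add: By D0)
  qed
  moreover have "Re s < 0"
    using \<open>Re p > 0\<close> by (simp add: s_def)
  ultimately have "s \<in> eigenvalues (closed_loop A B)"
    unfolding eigenvalues_closed_loop_iff s[symmetric] by blast
  moreover have "(1 - \<rho>) * (Re s)\<^sup>2 \<le> (norm (adj B *v v k))\<^sup>2"
    using loc(2)[OF p(1)] p(2) by (simp add: s_def b_def)
  ultimately show thesis by (rule that)
qed

end

section \<open>Numerical constants and the final bounds\<close>

text \<open>With \<open>h\<close> half the gap, the claim \<rho> < (3/4) \<phi> amounts to (2 - sqrt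
  2)^2 < 3/8.\<close>

lemma phi_less_1D:
  fixes B :: "complex^'m^'n"
  assumes "phi B lam k < 1" "k \<in> {1..CARD('n)}" "CARD('n) \<ge> 2" and B: "onorm ((*v) B) > 0"
  defines "h \<equiv> spectral_gap CARD('n) lam k / 2"
  obtains \<phi> where "phi B lam k = ereal \<phi>" "0 < \<phi>" "\<phi> < 1" "0 < h"
    "(onorm ((*v) B))\<^sup>2 / h\<^sup>2 < 3/4 * \<phi>"
    "\<And>j. j \<in> {1..CARD('n)} - {k} \<Longrightarrow> 2 * h \<le> \<bar>lam j - lam k\<bar>"
proof -
  define \<delta> where "\<delta> = spectral_gap CARD('n) lam k"
  define c where "c = onorm ((*v) B)"
  define \<phi> where "\<phi> = 2 * c\<^sup>2 / ((2 - sqrt 2)\<^sup>2 * \<delta>\<^sup>2)"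
  have gap: "\<delta> \<le> \<bar>lam j - lam k\<bar>" if "j \<in> {1..CARD('n)} - {k}" for j
    unfolding \<delta>_def spectral_gap_def using that by (intro Min_le) auto
  have "(if k = 1 then 2 else 1) \<in> {1..CARD('n)} - {k}"
    using assms(3) by auto
  then have "{1..CARD('n)} - {k} \<noteq> {}" by blast
  then have "\<delta> \<in> (\<lambda>j. \<bar>lam j - lam k\<bar>) ` ({1..CARD('n)} - {k})"
    unfolding \<delta>_def spectral_gap_def by (intro Min_in) auto
  moreover have "\<delta> \<noteq> 0"
    using assms(1) by (auto simp: phi_def \<delta>_def)
  ultimately have "0 < \<delta>" by auto
  have phi: "phi B lam k = ereal \<phi>"
    using \<open>\<delta> \<noteq> 0\<close> by (simp add: phi_def \<phi>_def \<delta>_def c_def Let_def)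
  \<comment> \<open>The square is 6 - 4 sqrt 2: the lower bound on sqrt 2 puts it below 3/8, the
    upper one makes it positive.\<close>
  have "1.41 < sqrt 2"
    by (rule real_less_rsqrt) (simp add: power2_eq_square)
  moreover have "sqrt 2 < 3/2"
    by (rule real_less_lsqrt) (simp_all add: power2_eq_square)
  ultimately have "(2 - sqrt 2)\<^sup>2 < 3/8" "0 < (2 - sqrt 2)\<^sup>2"
    by (simp_all add: power2_diff)
  then have "4 < 3/4 * (2 / (2 - sqrt 2)\<^sup>2)"
    by (simp add: field_simps)
  moreover have "0 < c\<^sup>2 / \<delta>\<^sup>2"
    using B \<open>0 < \<delta>\<close> by (simp add: c_def)
  ultimately have "4 * (c\<^sup>2 / \<delta>\<^sup>2) < 3/4 * (2 / (2 - sqrt 2)\<^sup>2) * (c\<^sup>2 / \<delta>\<^sup>2)"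
    by (rule mult_strict_right_mono)
  then have "c\<^sup>2 / h\<^sup>2 < 3/4 * \<phi>"
    by (simp add: h_def \<delta>_def[symmetric] \<phi>_def power_divide)
  moreover have "0 < \<phi>"
    unfolding \<phi>_def using B \<open>0 < \<delta>\<close> \<open>0 < (2 - sqrt 2)\<^sup>2\<close> by (simp add: c_def)
  moreover have "\<phi> < 1"
    using assms(1) by (simp add: phi one_ereal_def)
  ultimately show thesis
    using that phi gap \<open>0 < \<delta>\<close> by (simp add: h_def \<delta>_def c_def)
qed

text \<open>(1 + \<phi>)^2 (1 - 3\<phi>/4) = 1 + 5\<phi>/4 - \<phi>^2/2 - 3\<phi>^3/4 is at least 1,
  because \<phi>^2 and \<phi>^3 are at most \<phi> and 5/4 = 1/2 + 3/4. Strictness comes from \<rho>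
  < 3\<phi>/4.\<close>

lemma upper_bound_arith:
  fixes a \<beta> \<rho> \<phi> :: real
  assumes "0 < \<phi>" "\<phi> < 1" "\<rho> < 3/4 * \<phi>" "0 < \<beta>" "(1 - \<rho>) * a\<^sup>2 \<le> \<beta>\<^sup>2"
  shows "a < (1 + \<phi>) * \<beta>"
proof -
  have "\<phi>\<^sup>2 \<le> \<phi>" "\<phi>^3 \<le> \<phi>"
    using assms(1,2) power_decreasing[of 1 2 \<phi>] power_decreasing[of 1 3 \<phi>] by simp_all
  then have "1 \<le> (1 + \<phi>)\<^sup>2 * (1 - 3/4 * \<phi>)"
    by (simp add: algebra_simps power2_eq_square power3_eq_cube)
  also have "\<dots> < (1 + \<phi>)\<^sup>2 * (1 - \<rho>)"
    using assms by (intro mult_strict_left_mono) auto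
  finally have "1 * \<beta>\<^sup>2 < ((1 + \<phi>)\<^sup>2 * (1 - \<rho>)) * \<beta>\<^sup>2"
    using \<open>0 < \<beta>\<close> by (intro mult_strict_right_mono) auto
  with assms(5) have "(1 - \<rho>) * a\<^sup>2 < (1 - \<rho>) * ((1 + \<phi>) * \<beta>)\<^sup>2"
    by (simp add: power_mult_distrib mult_ac)
  then have "a\<^sup>2 < ((1 + \<phi>) * \<beta>)\<^sup>2"
    using assms by simp
  then show ?thesis
    using assms by (intro power_less_imp_less_base[of a 2]) auto
qed

text \<open>The point is (1 - \<phi>)^2 (1 + \<phi>) = (1 - \<phi>) (1 - \<phi>^2) < 1.\<close>

lemma lower_bound_arith:
  fixes a \<beta> \<rho> \<phi> :: real
  assumes "0 < \<phi>" "\<phi> < 1" "\<rho> < \<phi>" "0 < \<beta>" "0 \<le> a" "\<beta>\<^sup>2 \<le> (1 + \<rho>) * a\<^sup>2"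
  shows "(1 - \<phi>) * \<beta> < a"
proof -
  have "a \<noteq> 0" using assms by auto
  have "(1 - \<phi>)\<^sup>2 * (1 + \<phi>) = (1 - \<phi>) * (1 - \<phi>\<^sup>2)"
    by (simp add: algebra_simps power2_eq_square)
  also have "\<dots> < 1 * 1"
    using assms by (intro mult_strict_mono) (auto simp: abs_square_less_1 power_le_one)
  finally have "(1 - \<phi>)\<^sup>2 * (1 + \<phi>) * a\<^sup>2 < 1 * a\<^sup>2"
    using \<open>a \<noteq> 0\<close> by (intro mult_strict_right_mono) auto
  moreover have "(1 - \<phi>)\<^sup>2 * \<beta>\<^sup>2 \<le> (1 - \<phi>)\<^sup>2 * ((1 + \<phi>) * a\<^sup>2)"
  proof (intro mult_left_mono)
    show "\<beta>\<^sup>2 \<le> (1 + \<phi>) * a\<^sup>2"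
      using assms by (meson add_left_mono less_imp_le mult_right_mono order_trans zero_le_power2)
  qed simp
  ultimately have "((1 - \<phi>) * \<beta>)\<^sup>2 < a\<^sup>2"
    by (simp add: power_mult_distrib mult_ac)
  then show ?thesis
    using assms(5) by (rule power_less_imp_less_base)
qed

theorem corollary11:
  fixes A :: "complex^'n^'n" and B :: "complex^'m^'n"
    and lam :: "nat \<Rightarrow> real" and v :: "nat \<Rightarrow> complex^'n"
  assumes "CARD('n) \<ge> 2" and "CARD('m) \<le> CARD('n)"
    and "skew_hermitian A"
    and "{u. B *v u = 0} = {0}"
    and "stabilizable A B"
    and "mono_on {1..CARD('n)} lam"
    and "orthonormal_basis {1..CARD('n)} v"
    and "\<And>j. j \<in> {1..CARD('n)} \<Longrightarrow> A *v v j = (\<i> * complex_of_real (lam j)) *s v j"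
    and "\<exists>k\<in>{1..CARD('n)}. phi B lam k < 1"
  shows "ereal (gamma_decay A B) < Gamma_plus B lam v \<and>
    ((\<forall>k\<in>{1..CARD('n)}. phi B lam k < 1) \<longrightarrow>
      Gamma_minus B lam v < ereal (gamma_decay A B) \<and>
      ereal (gamma_decay A B) < Gamma_plus B lam v)"
proof -
  let ?I = "{1..CARD('n)}" and ?c = "onorm ((*v) B)"
  let ?ev = "eigenvalues (closed_loop A B)" and ?b = "\<lambda>k. norm (adj B *v v k)"
  define g where "g = gamma_decay A B"
  interpret regulator A B ?I lam v
    using assms by unfold_locales (auto simp: skew_hermitian_def)
  have b: "0 < ?b k" if "k \<in> ?I" for k
    using adj_B_basis[OF that] by simp
  have c: "0 < ?c"
  proof -
    have "1 \<in> ?I" using assms(1) by auto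
    from less_le_trans[OF b[OF this] norm_adj_vec_le] show ?thesis
      using norm_basis[OF \<open>1 \<in> ?I\<close>] by simp
  qed
  have fin: "finite ((\<lambda>\<nu>. \<bar>Re \<nu>\<bar>) ` ?ev)"
    by (intro finite_imageI finite_eigenvalues)
  have near: "\<exists>s\<in>?ev. ereal \<bar>Re s\<bar> < (1 + phi B lam k) * ereal (?b k)"
    if k: "k \<in> ?I" "phi B lam k < 1" for k
  proof -
    define h where "h = spectral_gap CARD('n) lam k / 2"
    obtain \<phi> where \<phi>: "phi B lam k = ereal \<phi>" "0 < \<phi>" "\<phi> < 1" "0 < h" "?c\<^sup>2 / h\<^sup>2 < 3/4 * \<phi>"
      and gap: "\<And>j. j \<in> ?I - {k} \<Longrightarrow> 2 * h \<le> \<bar>lam j - lam k\<bar>"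
      unfolding h_def using phi_less_1D[OF k(2,1) assms(1) c] by metis
    have "?c\<^sup>2 / h\<^sup>2 < 3/4" using \<phi>(3,5) by linarith
    then obtain s where s: "s \<in> ?ev" "(1 - ?c\<^sup>2 / h\<^sup>2) * (Re s)\<^sup>2 \<le> (?b k)\<^sup>2"
      using eigenvalue_exists[OF k(1) \<phi>(4) gap refl] by blast
    then have "\<bar>Re s\<bar> < (1 + \<phi>) * ?b k"
      using \<phi> b[OF k(1)] by (intro upper_bound_arith[of \<phi> "?c\<^sup>2 / h\<^sup>2"]) simp_all
    then show ?thesis
      using s(1) by (auto simp: \<phi>(1) one_ereal_def)
  qed
  have upper: "ereal g < Gamma_plus B lam v"
  proof -
    let ?K = "{k \<in> ?I. phi B lam k < 1}"
    have "Gamma_plus B lam v \<in> (\<lambda>k. (1 + phi B lam k) * ereal (?b k)) ` ?K"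
      unfolding Gamma_plus_def using assms(9) by (intro Min_in) auto
    then obtain k where k: "k \<in> ?I" "phi B lam k < 1"
      and G: "Gamma_plus B lam v = (1 + phi B lam k) * ereal (?b k)" by auto
    obtain s where s: "s \<in> ?ev" "ereal \<bar>Re s\<bar> < Gamma_plus B lam v"
      using near[OF k] unfolding G by blast
    have "g \<le> \<bar>Re s\<bar>"
      unfolding g_def gamma_decay_def using fin s(1) by (intro Min_le) auto
    then have "ereal g \<le> ereal \<bar>Re s\<bar>" by simp
    from le_less_trans[OF this s(2)] show ?thesis .
  qed
  have lower: "Gamma_minus B lam v < ereal g" if all: "\<forall>k\<in>?I. phi B lam k < 1"
  proof -
    \<comment> \<open>Nonemptiness is needed for the \<open>Min\<close> in
      \<open>gamma_decay\<close> to be attained.\<close>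
    have "?ev \<noteq> {}" using near assms(9) by blast
    then have "g \<in> (\<lambda>\<nu>. \<bar>Re \<nu>\<bar>) ` ?ev"
      unfolding g_def gamma_decay_def using fin by (intro Min_in) auto
    then obtain s where s: "s \<in> ?ev" "g = \<bar>Re s\<bar>" by blast
    obtain k where k: "k \<in> ?I" and nearest: "\<And>j. j \<in> ?I \<Longrightarrow> \<bar>lam k - Im s\<bar> \<le> \<bar>lam j - Im s\<bar>"
      using ex_min_if_finite[of "(\<lambda>j. \<bar>lam j - Im s\<bar>) ` ?I"] assms(1) by (force simp: not_less)
    define h where "h = spectral_gap CARD('n) lam k / 2"
    obtain \<phi> where \<phi>: "phi B lam k = ereal \<phi>" "0 < \<phi>" "\<phi> < 1" "0 < h" "?c\<^sup>2 / h\<^sup>2 < 3/4 * \<phi>"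
      and gap: "\<And>j. j \<in> ?I - {k} \<Longrightarrow> 2 * h \<le> \<bar>lam j - lam k\<bar>"
      unfolding h_def using phi_less_1D[OF _ k assms(1) c] all k by metis
    have "?c\<^sup>2 / h\<^sup>2 < \<phi>" using \<phi>(2,5) by linarith
    then have \<rho>: "?c\<^sup>2 / h\<^sup>2 < 1" using \<phi>(3) by linarith
    \<comment> \<open>By the triangle inequality and the choice of \<open>k\<close>, the gap 2h is
      at most twice the distance from \<open>lam j\<close> to \<open>Im s\<close>.\<close>
    have "h \<le> \<bar>lam j - Im s\<bar>" if "j \<in> ?I - {k}" for j
      using gap[OF that] nearest[of j] that by auto
    then obtain u where u: "norm (adj B *v v k - u) \<le> ?c\<^sup>2 / h\<^sup>2 * norm u"
      "cinner (adj B *v v k) u = (\<i> * complex_of_real (lam k) - s)\<^sup>2"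
      using eigenvalue_near[OF s(1) k \<phi>(4) _ refl \<rho>] by blast
    have "(?b k)\<^sup>2 \<le> (1 + ?c\<^sup>2 / h\<^sup>2) * g\<^sup>2"
      using quadratic_localization(1)[OF _ \<rho> u adj_B_basis[OF k]] by (simp add: s(2))
    then have "(1 - \<phi>) * ?b k < g"
      using \<phi> b[OF k] s(2) \<open>?c\<^sup>2 / h\<^sup>2 < \<phi>\<close> by (intro lower_bound_arith[of \<phi> "?c\<^sup>2 / h\<^sup>2"]) simp_all
    then have "(1 - phi B lam k) * ereal (?b k) < ereal g"
      by (simp add: \<phi>(1) one_ereal_def)
    moreover have "Gamma_minus B lam v \<le> (1 - phi B lam k) * ereal (?b k)"
      unfolding Gamma_minus_def using k by (intro Min_le) auto
    ultimately show ?thesis by (rule le_less_trans[rotated])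
  qed
  show ?thesis
    using upper lower by (simp add: g_def)
qed

end
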